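(* There is a sentence $\varphi$ of first-order arithmetic that is $\mu$-realisable but not (Kleene) realisable.
   Context: Sentences are in the first-order language of arithmetic (symbols $0,S,+,\cdot$ and $=$; $\neg\varphi$ abbreviates $\varphi\to\bot$). Programs are oracle Turing programs, identified with natural-number codes via a fixed computable enumeration; sentences are identified with their codes. For a program $p$, oracle $u\in 2^\omega$ and $n\in\mathbb N$, $p^u(n)$ denotes the output of $p$ on input $n$ with $u$ on the oracle tape. Ordinary programs are those not using the oracle; for these $e(n)$ denotes the output on input $n$. $\mu$ is the Lebesgue (fair-coin) measure on Cantor space $2^\omega$. Kleene realisability $e\Vdash\varphi$ (for sentences): never $e\Vdash\bot$; $e\Vdash t=s$ iff $t,s$ have the same value in $\mathbb N$; $e\Vdash\varphi\wedge\psi$ iff $e(0)\Vdash\varphi$ and $e(1)\Vdash\psi$; $e\Vdash\varphi\vee\psi$ iff $e(0)=0$ and $e(1)\Vdash\varphi$, or $e(0)=1$ and $e(1)\Vdash\psi$; $e\Vdash\varphi\to\psi$ iff for all $s\Vdash\varphi$, $e(s)$ is defined and $e(s)\Vdash\psi$; $e\Vdash\exists x\varphi(x)$ iff $e(0)\Vdash\varphi(e(1))$; $e\Vdash\forall x\varphi(x)$ iff $e(n)\Vdash\varphi(n)$ for all $n$ (all outputs mentioned are required to exist). $\varphi$ is realisable if some $e\Vdash\varphi$. $\mu$-realisability: relations $(p,u)\Vdash_O\varphi$ and $p\Vdash_\mu\varphi$ are defined by simultaneous recursion on the sentence $\varphi$: never $(p,u)\Vdash_O\bot$; $(p,u)\Vdash_O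 t=s$ iff $t,s$ have the same value; $(p,u)\Vdash_O\varphi\wedge\psi$ iff $(p^u(0),u)\Vdash_O\varphi$ and $(p^u(1),u)\Vdash_O\psi$; $(p,u)\Vdash_O\varphi\vee\psi$ iff $p^u(0)=0$ and $(p^u(1),u)\Vdash_O\varphi$, or $p^u(0)=1$ and $(p^u(1),u)\Vdash_O\psi$; $(p,u)\Vdash_O\varphi\to\psi$ iff for every $s$ with $s\Vdash_\mu\varphi$ we have $p^u(s)\Vdash_\mu\psi$; $(p,u)\Vdash_O\exists x\varphi(x)$ iff $(p^u(0),u)\Vdash_O\varphi(p^u(1))$; $(p,u)\Vdash_O\forall x\varphi(x)$ iff $(p^u(n),u)\Vdash_O\varphi(n)$ for all $n$ (outputs mentioned are required to exist). Let $C_{p,\varphi}=\{u\in2^\omega:(p,u)\Vdash_O\varphi\}$. Write $p\Vdash_\mu\varphi\ge r$ iff $\mu(C_{p,\varphi})\ge r$, and $p\Vdash_\mu\varphi$ iff $p\Vdash_\mu\varphi\ge r$ for some real $r>0$. A sentence $\varphi$ is $\mu$-realisable iff $\sup\{\mu(C_{p,\varphi}):p\Vdash_\mu\varphi\}=1$. *)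

theory Defs
  imports "HOL-Probability.Probability"
begin

section \<open>Oracle Turing programs\<close>

text \<open>
  A machine has a two-way infinite read/write work tape over the alphabet \<open>{blank, 0, 1}\<close> and a
  read-only one-way infinite oracle tape carrying \<open>u \<in> 2\<^sup>\<omega>\<close>, each with its own head.
  \<open>None\<close> is the blank.
\<close>

type_synonym cell = "bool option"

datatype move = MLeft | MStay | MRight

text \<open>Symbol written, move of the work head, move of the oracle head, next state.\<close>

type_synonym instr = "cell \<times> move \<times> move \<times> nat"

text \<open>
  A configuration is the state, the work tape to the left of the head (nearest cell first), the work
  tape from the head rightwards, and the position of the oracle head. Beyond the ends of the two
  lists the work tape is blank.
\<close>

type_synonym config = "nat \<times> cell list \<times> cell list \<times> nat"

subsection \<open>Numbers as bit strings\<close>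

text \<open>
  Bijective base-2 numeration, least significant digit first: \<open>False\<close> is the digit 1 and \<open>True\<close> is
  the digit 2. Under it all bit strings, including the empty one, correspond bijectively to the
  natural numbers. It is used for inputs, outputs and codes of programs alike.
\<close>

fun nat_of_bits :: "bool list \<Rightarrow> nat" where
  "nat_of_bits [] = 0"
| "nat_of_bits (b # bs) = Suc (of_bool b + 2 * nat_of_bits bs)"

fun bits_of_nat :: "nat \<Rightarrow> bool list" where
  "bits_of_nat 0 = []"
| "bits_of_nat (Suc n) = odd n # bits_of_nat (n div 2)"

lemma nat_of_bits_of_nat [simp]: "nat_of_bits (bits_of_nat n) = n"
  by (induction n rule: bits_of_nat.induct) (auto simp: of_bool_def elim!: oddE)

lemma bits_of_nat_of_bits [simp]: "bits_of_nat (nat_of_bits bs) = bs"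
  by (induction bs) auto

subsection \<open>The enumeration of programs\<close>

text \<open>
  A program is a finite transition table, given as a list \<open>T\<close> of numbers. State \<open>q\<close> owns six
  consecutive entries of \<open>T\<close>, one for each pair of a scanned work symbol and a scanned oracle bit.
  An entry codes an instruction in mixed radix; its last component is \<open>0\<close> for ``continue with
  state \<open>q + 1\<close>'' and \<open>q' + 1\<close> for ``continue with state \<open>q'\<close>''. There is no applicable instruction
  beyond the end of the table.
\<close>

fun symbol_index :: "cell \<Rightarrow> nat" where
  "symbol_index None = 0"
| "symbol_index (Some False) = 1"
| "symbol_index (Some True) = 2"

definition decode_instr :: "nat \<Rightarrow> nat \<Rightarrow> instr" where
  "decode_instr q a =
     ([None, Some False, Some True] ! (a mod 3),
      [MLeft, MStay, MRight] ! (a div 3 mod 3),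
      [MLeft, MStay, MRight] ! (a div 9 mod 3),
      (case a div 27 of 0 \<Rightarrow> Suc q | Suc q' \<Rightarrow> q'))"

definition instr :: "nat list \<Rightarrow> nat \<Rightarrow> cell \<Rightarrow> bool \<Rightarrow> instr option" where
  "instr T q s b =
     (let i = 6 * q + 2 * symbol_index s + of_bool b
      in if i < length T then Some (decode_instr q (T ! i)) else None)"

text \<open>
  A bit string codes the table whose entries are the lengths of its successive blocks of \<open>True\<close>,
  each block being terminated by \<open>False\<close>; an unterminated last block is dropped. So every natural
  number is the code of a program, and every program has a code.
\<close>

fun blocks :: "nat \<Rightarrow> bool list \<Rightarrow> nat list" where
  "blocks a [] = []"
| "blocks a (False # bs) = a # blocks 0 bs"
| "blocks a (True # bs) = blocks (Suc a) bs"

definition table :: "nat \<Rightarrow> nat list" where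
  "table p = blocks 0 (bits_of_nat p)"

lemma blocks_replicate: "blocks k (replicate a True @ bs) = blocks (k + a) bs"
  by (induction a arbitrary: k) auto

lemma ex_table: "\<exists>p. table p = T"
proof -
  have "blocks 0 (concat (map (\<lambda>a. replicate a True @ [False]) T)) = T"
    by (induction T) (auto simp: blocks_replicate)
  then show ?thesis
    unfolding table_def by (metis bits_of_nat_of_bits)
qed

subsection \<open>Computations\<close>

fun scan :: "cell list \<Rightarrow> cell" where
  "scan [] = None"
| "scan (x # xs) = x"

fun move_tape :: "move \<Rightarrow> cell list \<times> cell list \<Rightarrow> cell list \<times> cell list" where
  "move_tape MLeft (l, r) = (tl l, scan l # r)"
| "move_tape MStay (l, r) = (l, r)"
| "move_tape MRight (l, r) = (scan r # l, tl r)"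

text \<open>The oracle head stays put when told to move left from position \<open>0\<close>.\<close>

fun move_oracle :: "move \<Rightarrow> nat \<Rightarrow> nat" where
  "move_oracle MLeft h = h - 1"
| "move_oracle MStay h = h"
| "move_oracle MRight h = Suc h"

fun step :: "(nat \<Rightarrow> bool) \<Rightarrow> nat list \<Rightarrow> config \<Rightarrow> config option" where
  "step u T (q, l, r, h) =
     (case instr T q (scan r) (u h) of
        None \<Rightarrow> None
      | Some (s, m, m', q') \<Rightarrow>
          (let (l', r') = move_tape m (l, s # tl r) in Some (q', l', r', move_oracle m' h)))"

definition init_config :: "nat \<Rightarrow> config" where
  "init_config n = (0, [], map Some (bits_of_nat n), 0)"

text \<open>The output is the bit string from the head rightwards up to the first blank.\<close>

fun tape_output :: "config \<Rightarrow> nat" where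
  "tape_output (q, l, r, h) = nat_of_bits (map the (takeWhile (\<lambda>x. x \<noteq> None) r))"

inductive halts_with :: "(nat \<Rightarrow> bool) \<Rightarrow> nat list \<Rightarrow> config \<Rightarrow> nat \<Rightarrow> bool"
  for u :: "nat \<Rightarrow> bool" and T :: "nat list" where
  halt: "step u T c = None \<Longrightarrow> halts_with u T c (tape_output c)"
| run: "step u T c = Some c' \<Longrightarrow> halts_with u T c' n \<Longrightarrow> halts_with u T c n"

text \<open>\<open>computes u p n m\<close> says that \<open>p\<^sup>u(n)\<close> is defined and equal to \<open>m\<close>.\<close>

definition computes :: "(nat \<Rightarrow> bool) \<Rightarrow> nat \<Rightarrow> nat \<Rightarrow> nat \<Rightarrow> bool" where
  "computes u p n m \<longleftrightarrow> halts_with u (table p) (init_config n) m"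

lemma halts_with_unique: "halts_with u T c m \<Longrightarrow> halts_with u T c m' \<Longrightarrow> m = m'"
proof (induction rule: halts_with.induct)
  case (halt c)
  then show ?case by (auto elim: halts_with.cases)
next
  case (run c c' n)
  from run.prems run.hyps(1) run.IH show ?case
    by (cases rule: halts_with.cases) auto
qed

lemma computes_unique: "computes u p n m \<Longrightarrow> computes u p n m' \<Longrightarrow> m = m'"
  unfolding computes_def by (rule halts_with_unique)

text \<open>
  Ordinary programs are those whose instructions never depend on the scanned oracle bit; for them
  the choice of the oracle is immaterial, and \<open>e(n)\<close> is computed with the zero oracle.
\<close>

definition ordinary :: "nat \<Rightarrow> bool" where
  "ordinary e \<longleftrightarrow> (\<forall>q s. instr (table e) q s False = instr (table e) q s True)"

definition app :: "nat \<Rightarrow> nat \<Rightarrow> nat \<Rightarrow> bool" where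
  "app e n m \<longleftrightarrow> computes (\<lambda>_. False) e n m"

lemma halts_with_cong:
  "halts_with u T c n \<Longrightarrow> (\<And>c. step u T c = step v T c) \<Longrightarrow> halts_with v T c n"
  by (induction rule: halts_with.induct) (auto intro: halts_with.intros)

lemma ordinary_computes:
  assumes "ordinary e"
  shows "computes u e n m \<longleftrightarrow> app e n m"
proof -
  have "instr (table e) q s b = instr (table e) q s False" for q s b
    using assms by (cases b) (auto simp: ordinary_def)
  then have eq: "step u (table e) c = step (\<lambda>_. False) (table e) c" for c
    by (cases c) (metis step.simps)
  show ?thesis
    unfolding computes_def app_def using halts_with_cong eq by metis
qed

section \<open>First-order arithmetic\<close>

text \<open>Variables are de Bruijn indices; negation is implication of falsum.\<close>

datatype tm = Var nat | Zero | Succ tm | Plus tm tm | Times tm tm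

datatype fm =
    Falsum
  | Eq tm tm
  | Conj fm fm
  | Disj fm fm
  | Imp fm fm
  | Exists fm
  | Forall fm

fun closed_tm :: "nat \<Rightarrow> tm \<Rightarrow> bool" where
  "closed_tm k (Var i) \<longleftrightarrow> i < k"
| "closed_tm k Zero \<longleftrightarrow> True"
| "closed_tm k (Succ t) \<longleftrightarrow> closed_tm k t"
| "closed_tm k (Plus t s) \<longleftrightarrow> closed_tm k t \<and> closed_tm k s"
| "closed_tm k (Times t s) \<longleftrightarrow> closed_tm k t \<and> closed_tm k s"

fun closed_fm :: "nat \<Rightarrow> fm \<Rightarrow> bool" where
  "closed_fm k Falsum \<longleftrightarrow> True"
| "closed_fm k (Eq t s) \<longleftrightarrow> closed_tm k t \<and> closed_tm k s"
| "closed_fm k (Conj \<phi> \<psi>) \<longleftrightarrow> closed_fm k \<phi> \<and> closed_fm k \<psi>"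
| "closed_fm k (Disj \<phi> \<psi>) \<longleftrightarrow> closed_fm k \<phi> \<and> closed_fm k \<psi>"
| "closed_fm k (Imp \<phi> \<psi>) \<longleftrightarrow> closed_fm k \<phi> \<and> closed_fm k \<psi>"
| "closed_fm k (Exists \<phi>) \<longleftrightarrow> closed_fm (Suc k) \<phi>"
| "closed_fm k (Forall \<phi>) \<longleftrightarrow> closed_fm (Suc k) \<phi>"

definition sentence :: "fm \<Rightarrow> bool" where
  "sentence \<phi> \<longleftrightarrow> closed_fm 0 \<phi>"

fun numeral_tm :: "nat \<Rightarrow> tm" where
  "numeral_tm 0 = Zero"
| "numeral_tm (Suc n) = Succ (numeral_tm n)"

text \<open>
  \<open>inst_fm k n \<phi>\<close> replaces the variable \<open>k\<close> by the numeral of \<open>n\<close> and lowers the higher variables by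
  one. Numerals are closed, so no lifting is needed under quantifiers. For a sentence
  \<open>Exists \<phi>\<close> or \<open>Forall \<phi>\<close>, the instance \<open>\<phi>(n)\<close> is \<open>inst_fm 0 n \<phi>\<close>.
\<close>

fun inst_tm :: "nat \<Rightarrow> nat \<Rightarrow> tm \<Rightarrow> tm" where
  "inst_tm k n (Var i) = (if i < k then Var i else if i = k then numeral_tm n else Var (i - 1))"
| "inst_tm k n Zero = Zero"
| "inst_tm k n (Succ t) = Succ (inst_tm k n t)"
| "inst_tm k n (Plus t s) = Plus (inst_tm k n t) (inst_tm k n s)"
| "inst_tm k n (Times t s) = Times (inst_tm k n t) (inst_tm k n s)"

fun inst_fm :: "nat \<Rightarrow> nat \<Rightarrow> fm \<Rightarrow> fm" where
  "inst_fm k n Falsum = Falsum"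
| "inst_fm k n (Eq t s) = Eq (inst_tm k n t) (inst_tm k n s)"
| "inst_fm k n (Conj \<phi> \<psi>) = Conj (inst_fm k n \<phi>) (inst_fm k n \<psi>)"
| "inst_fm k n (Disj \<phi> \<psi>) = Disj (inst_fm k n \<phi>) (inst_fm k n \<psi>)"
| "inst_fm k n (Imp \<phi> \<psi>) = Imp (inst_fm k n \<phi>) (inst_fm k n \<psi>)"
| "inst_fm k n (Exists \<phi>) = Exists (inst_fm (Suc k) n \<phi>)"
| "inst_fm k n (Forall \<phi>) = Forall (inst_fm (Suc k) n \<phi>)"

text \<open>Only used for closed terms, so the value of a variable is irrelevant.\<close>

fun val :: "tm \<Rightarrow> nat" where
  "val (Var i) = 0"
| "val Zero = 0"
| "val (Succ t) = Suc (val t)"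
| "val (Plus t s) = val t + val s"
| "val (Times t s) = val t * val s"

fun depth :: "fm \<Rightarrow> nat" where
  "depth Falsum = 0"
| "depth (Eq t s) = 0"
| "depth (Conj \<phi> \<psi>) = Suc (max (depth \<phi>) (depth \<psi>))"
| "depth (Disj \<phi> \<psi>) = Suc (max (depth \<phi>) (depth \<psi>))"
| "depth (Imp \<phi> \<psi>) = Suc (max (depth \<phi>) (depth \<psi>))"
| "depth (Exists \<phi>) = Suc (depth \<phi>)"
| "depth (Forall \<phi>) = Suc (depth \<phi>)"

lemma depth_inst_fm [simp]: "depth (inst_fm k n \<phi>) = depth \<phi>"
  by (induction \<phi> arbitrary: k) auto

lemma closed_numeral_tm [simp]: "closed_tm k (numeral_tm n)"
  by (induction n) auto

lemma closed_inst_tm: "closed_tm (Suc m) t \<Longrightarrow> k \<le> m \<Longrightarrow> closed_tm m (inst_tm k n t)"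
  by (induction t) auto

lemma closed_inst_fm: "closed_fm (Suc m) \<phi> \<Longrightarrow> k \<le> m \<Longrightarrow> closed_fm m (inst_fm k n \<phi>)"
  by (induction \<phi> arbitrary: k m) (auto simp: closed_inst_tm)

section \<open>Kleene realisability\<close>

function realises :: "nat \<Rightarrow> fm \<Rightarrow> bool" where
  "realises e Falsum \<longleftrightarrow> False"
| "realises e (Eq t s) \<longleftrightarrow> ordinary e \<and> val t = val s"
| "realises e (Conj \<phi> \<psi>) \<longleftrightarrow> ordinary e \<and>
     (\<exists>a. app e 0 a \<and> realises a \<phi>) \<and> (\<exists>b. app e 1 b \<and> realises b \<psi>)"
| "realises e (Disj \<phi> \<psi>) \<longleftrightarrow> ordinary e \<and>
     (app e 0 0 \<and> (\<exists>a. app e 1 a \<and> realises a \<phi>) \<or>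
      app e 0 1 \<and> (\<exists>a. app e 1 a \<and> realises a \<psi>))"
| "realises e (Imp \<phi> \<psi>) \<longleftrightarrow> ordinary e \<and>
     (\<forall>s. realises s \<phi> \<longrightarrow> (\<exists>a. app e s a \<and> realises a \<psi>))"
| "realises e (Exists \<phi>) \<longleftrightarrow> ordinary e \<and>
     (\<exists>a n. app e 0 a \<and> app e 1 n \<and> realises a (inst_fm 0 n \<phi>))"
| "realises e (Forall \<phi>) \<longleftrightarrow> ordinary e \<and>
     (\<forall>n. \<exists>a. app e n a \<and> realises a (inst_fm 0 n \<phi>))"
  by pat_completeness auto
termination
  by (relation "measures [\<lambda>(e, \<phi>). depth \<phi>]") auto

definition realisable :: "fm \<Rightarrow> bool" where
  "realisable \<phi> \<longleftrightarrow> (\<exists>e. realises e \<phi>)"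

section \<open>\<open>\<mu>\<close>-realisability\<close>

text \<open>The fair-coin measure on Cantor space.\<close>

definition coin :: "(nat \<Rightarrow> bool) measure" where
  "coin = PiM UNIV (\<lambda>_. measure_pmf (bernoulli_pmf (1/2)))"

lemma space_coin [simp]: "space coin = UNIV"
  by (simp add: coin_def space_PiM PiE_def)

text \<open>
  \<open>orealises p u \<phi>\<close> is \<open>(p, u) \<Vdash>\<^sub>O \<phi>\<close>, and \<open>mu_realises p \<phi>\<close> is \<open>p \<Vdash>\<^sub>\<mu> \<phi>\<close>.
\<close>

function orealises :: "nat \<Rightarrow> (nat \<Rightarrow> bool) \<Rightarrow> fm \<Rightarrow> bool"
  and mu_realises :: "nat \<Rightarrow> fm \<Rightarrow> bool" where
  "orealises p u Falsum \<longleftrightarrow> False"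
| "orealises p u (Eq t s) \<longleftrightarrow> val t = val s"
| "orealises p u (Conj \<phi> \<psi>) \<longleftrightarrow>
     (\<exists>a. computes u p 0 a \<and> orealises a u \<phi>) \<and> (\<exists>b. computes u p 1 b \<and> orealises b u \<psi>)"
| "orealises p u (Disj \<phi> \<psi>) \<longleftrightarrow>
     computes u p 0 0 \<and> (\<exists>a. computes u p 1 a \<and> orealises a u \<phi>) \<or>
     computes u p 0 1 \<and> (\<exists>a. computes u p 1 a \<and> orealises a u \<psi>)"
| "orealises p u (Imp \<phi> \<psi>) \<longleftrightarrow>
     (\<forall>s. mu_realises s \<phi> \<longrightarrow> (\<exists>a. computes u p s a \<and> mu_realises a \<psi>))"
| "orealises p u (Exists \<phi>) \<longleftrightarrow>
     (\<exists>a n. computes u p 0 a \<and> computes u p 1 n \<and> orealises a u (inst_fm 0 n \<phi>))"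
| "orealises p u (Forall \<phi>) \<longleftrightarrow>
     (\<forall>n. \<exists>a. computes u p n a \<and> orealises a u (inst_fm 0 n \<phi>))"
| "mu_realises p \<phi> \<longleftrightarrow> (\<exists>r::real. r > 0 \<and> emeasure coin {u. orealises p u \<phi>} \<ge> ennreal r)"
  by pat_completeness auto
termination
  by (relation "measures
        [\<lambda>x. case x of Inl (p, u, \<phi>) \<Rightarrow> depth \<phi> | Inr (p, \<phi>) \<Rightarrow> depth \<phi>,
         \<lambda>x. case x of Inl (p, u, \<phi>) \<Rightarrow> 0 | Inr (p, \<phi>) \<Rightarrow> 1]") auto

declare mu_realises.simps [simp del]

text \<open>The set \<open>C\<^sub>p\<^sub>,\<^sub>\<phi>\<close>.\<close>

definition realiser_set :: "nat \<Rightarrow> fm \<Rightarrow> (nat \<Rightarrow> bool) set" where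
  "realiser_set p \<phi> = {u. orealises p u \<phi>}"

definition mu_realises_ge :: "nat \<Rightarrow> fm \<Rightarrow> real \<Rightarrow> bool" where
  "mu_realises_ge p \<phi> r \<longleftrightarrow> emeasure coin (realiser_set p \<phi>) \<ge> ennreal r"

lemma mu_realises_iff: "mu_realises p \<phi> \<longleftrightarrow> (\<exists>r>0. mu_realises_ge p \<phi> r)"
  by (simp add: mu_realises.simps mu_realises_ge_def realiser_set_def)

text \<open>The supremum is taken in \<open>ennreal\<close>, where the supremum of the empty set is \<open>0\<close>.\<close>

definition mu_realisable :: "fm \<Rightarrow> bool" where
  "mu_realisable \<phi> \<longleftrightarrow> Sup {emeasure coin (realiser_set p \<phi>) | p. mu_realises p \<phi>} = 1"

subsection \<open>Measurability of the sets of oracles\<close>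

text \<open>
  \<open>emeasure\<close> is \<open>0\<close> on non-measurable sets; by the following no such set occurs in the definitions
  above.
\<close>

primrec halts_in :: "(nat \<Rightarrow> bool) \<Rightarrow> nat list \<Rightarrow> nat \<Rightarrow> config \<Rightarrow> nat \<Rightarrow> bool" where
  "halts_in u T 0 c n \<longleftrightarrow> step u T c = None \<and> tape_output c = n"
| "halts_in u T (Suc k) c n \<longleftrightarrow> (\<exists>c'. step u T c = Some c' \<and> halts_in u T k c' n)"

lemma halts_with_iff: "halts_with u T c n \<longleftrightarrow> (\<exists>k. halts_in u T k c n)"
proof
  assume "halts_with u T c n"
  then show "\<exists>k. halts_in u T k c n"
  proof (induction rule: halts_with.induct)
    case (halt c)
    then show ?case by (intro exI[of _ 0]) simp
  next
    case (run c c' n)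
    then obtain k where "halts_in u T k c' n" by blast
    with run show ?case by (intro exI[of _ "Suc k"]) simp
  qed
next
  assume "\<exists>k. halts_in u T k c n"
  then obtain k where "halts_in u T k c n" ..
  then show "halts_with u T c n"
    by (induction k arbitrary: c) (auto intro: halts_with.intros)
qed

lemma measurable_coin_component: "(\<lambda>u. u h) \<in> coin \<rightarrow>\<^sub>M count_space UNIV"
proof -
  have "(\<lambda>u. u h) \<in> coin \<rightarrow>\<^sub>M measure_pmf (bernoulli_pmf (1/2))"
    unfolding coin_def by (rule measurable_component_singleton) simp
  then show ?thesis by simp
qed

lemma measurable_step: "(\<lambda>u. step u T c) \<in> coin \<rightarrow>\<^sub>M count_space UNIV"
proof -
  obtain q l r h where c: "c = (q, l, r, h)" by (cases c)
  have "(\<lambda>b. step (\<lambda>_. b) T c) \<in> count_space UNIV \<rightarrow>\<^sub>M count_space UNIV"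
    by simp
  from measurable_compose[OF measurable_coin_component[of h] this]
  show ?thesis by (simp add: c)
qed

lemma pred_step: "Measurable.pred coin (\<lambda>u. step u T c = x)"
proof -
  have "(\<lambda>y. y = x) \<in> count_space UNIV \<rightarrow>\<^sub>M count_space UNIV"
    by simp
  from measurable_compose[OF measurable_step this] show ?thesis .
qed

lemma pred_halts_in: "Measurable.pred coin (\<lambda>u. halts_in u T k c n)"
proof (induction k arbitrary: c)
  case 0
  show ?case using pred_step by simp
next
  case (Suc k)
  have [measurable]: "Measurable.pred coin (\<lambda>u. halts_in u T k c' n)" for c'
    by (rule Suc.IH)
  note pred_step [measurable]
  show ?case by simp
qed

lemma pred_computes [measurable]: "Measurable.pred coin (\<lambda>u. computes u p n m)"
proof -
  note pred_halts_in [measurable]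
  show ?thesis unfolding computes_def halts_with_iff by measurable
qed

lemma pred_orealises: "Measurable.pred coin (\<lambda>u. orealises p u \<phi>)"
proof (induction "depth \<phi>" arbitrary: p \<phi> rule: less_induct)
  case less
  note IH [measurable] = less.hyps
  show ?case by (cases \<phi>) (simp_all add: less.hyps)
qed

lemma realiser_set_measurable: "realiser_set p \<phi> \<in> sets coin"
  using pred_orealises[of p \<phi>] by (simp add: realiser_set_def pred_def)

end

theory Submission
  imports Defs "HOL-Number_Theory.Cong" "HOL-Library.Nat_Bijection"
begin

text \<open>
  On negative formulas (without disjunction and existence) both notions of realisability coincide
  with truth, and there are realisers that depend only on the depth of the formula. Hence for a
  negative \<open>R\<close>, which may define any arithmetical relation, a realiser of \<open>\<forall>n. \<exists>x. R(n, x)\<close> is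
  essentially a program that finds an \<open>x\<close> for every \<open>n\<close>. For each ordinary program \<open>e\<close> choose an
  input \<open>n\<^sub>e\<close>, and let \<open>R\<close> exclude the value that \<open>e\<close> offers as a realiser at \<open>n\<^sub>e\<close>. Then no
  ordinary program is a realiser, whereas an oracle program that answers the input \<open>n\<^sub>e\<close> with
  \<open>k + e\<close> bits of its oracle fails at \<open>n\<^sub>e\<close> with probability at most \<open>2\<close> to the power \<open>-(k + e)\<close>.

  No universal machine is needed, since excluding the value of \<open>e\<close> is an arithmetical condition,
  however undecidable. The inputs \<open>n\<^sub>e\<close> are so sparse and so long that their bits can be
  overwritten, in place, by the table of a machine that copies \<open>e\<close> oracle bits.
\<close>

section \<open>Arithmetical relations\<close>

text \<open>In a realiser of an existential statement a second program computes the witness, and it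
  reads the same oracle. So the program that receives \<open>n\<close> can leave the oracle alone:
  it only has to write down a machine that samples. The number of sampled bits grows with
  \<open>e\<close> because infinitely many programs have to be escaped at once, which needs failure
  probabilities with a small sum; the parameter \<open>k\<close> makes that sum,
  \<open>2 * (1/2) ^ k\<close>, as small as desired.

  A code is a concatenation of blocks, so appending instructions means appending bits, and one
  copier is a fixed bit string. Each full period written over the input therefore adds exactly one
  copier, without any counting. The obstacle is that inputs of other lengths cut the last copier
  short, and that one table has to yield the witness on input 1 and a realiser on input 0. Both are
  met by copiers that never jump and that leave a tape starting with \<open>True\<close> alone:
  every cut table still halts, and the constant realisers have codes starting with
  \<open>True\<close>.\<close>

fun eval :: "(nat \<Rightarrow> nat) \<Rightarrow> tm \<Rightarrow> nat" where
  "eval \<rho> (Var i) = \<rho> i"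
| "eval \<rho> Zero = 0"
| "eval \<rho> (Succ t) = Suc (eval \<rho> t)"
| "eval \<rho> (Plus t s) = eval \<rho> t + eval \<rho> s"
| "eval \<rho> (Times t s) = eval \<rho> t * eval \<rho> s"

fun sat :: "(nat \<Rightarrow> nat) \<Rightarrow> fm \<Rightarrow> bool" where
  "sat \<rho> Falsum \<longleftrightarrow> False"
| "sat \<rho> (Eq t s) \<longleftrightarrow> eval \<rho> t = eval \<rho> s"
| "sat \<rho> (Conj \<phi> \<psi>) \<longleftrightarrow> sat \<rho> \<phi> \<and> sat \<rho> \<psi>"
| "sat \<rho> (Disj \<phi> \<psi>) \<longleftrightarrow> sat \<rho> \<phi> \<or> sat \<rho> \<psi>"
| "sat \<rho> (Imp \<phi> \<psi>) \<longleftrightarrow> (sat \<rho> \<phi> \<longrightarrow> sat \<rho> \<psi>)"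
| "sat \<rho> (Exists \<phi>) \<longleftrightarrow> (\<exists>x. sat (case_nat x \<rho>) \<phi>)"
| "sat \<rho> (Forall \<phi>) \<longleftrightarrow> (\<forall>x. sat (case_nat x \<rho>) \<phi>)"

fun negative :: "fm \<Rightarrow> bool" where
  "negative Falsum \<longleftrightarrow> True"
| "negative (Eq t s) \<longleftrightarrow> True"
| "negative (Conj \<phi> \<psi>) \<longleftrightarrow> negative \<phi> \<and> negative \<psi>"
| "negative (Disj \<phi> \<psi>) \<longleftrightarrow> False"
| "negative (Imp \<phi> \<psi>) \<longleftrightarrow> negative \<phi> \<and> negative \<psi>"
| "negative (Exists \<phi>) \<longleftrightarrow> False"
| "negative (Forall \<phi>) \<longleftrightarrow> negative \<phi>"

section \<open>Renaming and instantiation of variables\<close>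

fun rename_tm :: "(nat \<Rightarrow> nat) \<Rightarrow> tm \<Rightarrow> tm" where
  "rename_tm \<sigma> (Var i) = Var (\<sigma> i)"
| "rename_tm \<sigma> Zero = Zero"
| "rename_tm \<sigma> (Succ t) = Succ (rename_tm \<sigma> t)"
| "rename_tm \<sigma> (Plus t s) = Plus (rename_tm \<sigma> t) (rename_tm \<sigma> s)"
| "rename_tm \<sigma> (Times t s) = Times (rename_tm \<sigma> t) (rename_tm \<sigma> s)"

fun rename_fm :: "(nat \<Rightarrow> nat) \<Rightarrow> fm \<Rightarrow> fm" where
  "rename_fm \<sigma> Falsum = Falsum"
| "rename_fm \<sigma> (Eq t s) = Eq (rename_tm \<sigma> t) (rename_tm \<sigma> s)"
| "rename_fm \<sigma> (Conj \<phi> \<psi>) = Conj (rename_fm \<sigma> \<phi>) (rename_fm \<sigma> \<psi>)"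
| "rename_fm \<sigma> (Disj \<phi> \<psi>) = Disj (rename_fm \<sigma> \<phi>) (rename_fm \<sigma> \<psi>)"
| "rename_fm \<sigma> (Imp \<phi> \<psi>) = Imp (rename_fm \<sigma> \<phi>) (rename_fm \<sigma> \<psi>)"
| "rename_fm \<sigma> (Exists \<phi>) = Exists (rename_fm (case_nat 0 (\<lambda>i. Suc (\<sigma> i))) \<phi>)"
| "rename_fm \<sigma> (Forall \<phi>) = Forall (rename_fm (case_nat 0 (\<lambda>i. Suc (\<sigma> i))) \<phi>)"

lemma eval_rename_tm: "eval \<rho> (rename_tm \<sigma> t) = eval (\<lambda>i. \<rho> (\<sigma> i)) t"
  by (induction t) auto

lemma sat_rename_fm: "sat \<rho> (rename_fm \<sigma> \<phi>) \<longleftrightarrow> sat (\<lambda>i. \<rho> (\<sigma> i)) \<phi>"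
proof (induction \<phi> arbitrary: \<rho> \<sigma>)
  case (Exists \<phi>)
  have "(\<lambda>i. case_nat x \<rho> (case_nat 0 (\<lambda>i. Suc (\<sigma> i)) i)) = case_nat x (\<lambda>i. \<rho> (\<sigma> i))" for x
    by (auto split: nat.split)
  then show ?case by (simp add: Exists)
next
  case (Forall \<phi>)
  have "(\<lambda>i. case_nat x \<rho> (case_nat 0 (\<lambda>i. Suc (\<sigma> i)) i)) = case_nat x (\<lambda>i. \<rho> (\<sigma> i))" for x
    by (auto split: nat.split)
  then show ?case by (simp add: Forall)
qed (auto simp: eval_rename_tm)

lemma negative_rename_fm [simp]: "negative (rename_fm \<sigma> \<phi>) \<longleftrightarrow> negative \<phi>"
  by (induction \<phi> arbitrary: \<sigma>) auto

lemma eval_numeral_tm [simp]: "eval \<rho> (numeral_tm n) = n"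
  by (induction n) auto

lemma eval_inst_tm:
  "eval \<rho> (inst_tm k n t) = eval (\<lambda>i. if i < k then \<rho> i else if i = k then n else \<rho> (i - 1)) t"
  by (induction t) auto

lemma sat_inst_fm:
  "sat \<rho> (inst_fm k n \<phi>) \<longleftrightarrow> sat (\<lambda>i. if i < k then \<rho> i else if i = k then n else \<rho> (i - 1)) \<phi>"
proof (induction \<phi> arbitrary: \<rho> k)
  case (Exists \<phi>)
  have "(\<lambda>i. if i < Suc k then case_nat x \<rho> i else if i = Suc k then n else case_nat x \<rho> (i - 1)) =
    case_nat x (\<lambda>i. if i < k then \<rho> i else if i = k then n else \<rho> (i - 1))" for x
    by (rule ext) (auto split: nat.split)
  then show ?case by (simp add: Exists)
next
  case (Forall \<phi>)
  have "(\<lambda>i. if i < Suc k then case_nat x \<rho> i else if i = Suc k then n else case_nat x \<rho> (i - 1)) =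
    case_nat x (\<lambda>i. if i < k then \<rho> i else if i = k then n else \<rho> (i - 1))" for x
    by (rule ext) (auto split: nat.split)
  then show ?case by (simp add: Forall)
qed (auto simp: eval_inst_tm)

lemma sat_inst_fm_0: "sat \<rho> (inst_fm 0 n \<phi>) \<longleftrightarrow> sat (case_nat n \<rho>) \<phi>"
proof -
  have "(\<lambda>i. if i < 0 then \<rho> i else if i = 0 then n else \<rho> (i - 1)) = case_nat n \<rho>"
    by (rule ext) (auto split: nat.split)
  then show ?thesis by (simp add: sat_inst_fm)
qed

lemma negative_inst_fm [simp]: "negative (inst_fm k n \<phi>) \<longleftrightarrow> negative \<phi>"
  by (induction \<phi> arbitrary: k) auto

lemma val_closed_tm: "closed_tm 0 t \<Longrightarrow> val t = eval \<rho> t"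
  by (induction t) auto

text \<open>Negative formulas, since these are the ones whose realisability amounts to truth.\<close>

definition arithmetical :: "((nat \<Rightarrow> nat) \<Rightarrow> bool) \<Rightarrow> bool" where
  "arithmetical P \<longleftrightarrow> (\<exists>\<phi>. negative \<phi> \<and> (\<forall>\<rho>. sat \<rho> \<phi> \<longleftrightarrow> P \<rho>))"

text \<open>Terms denote only polynomials, so any further function has to be given by its graph: the
  value is variable 0 and the arguments move up by one.\<close>

definition arith_fun :: "((nat \<Rightarrow> nat) \<Rightarrow> nat) \<Rightarrow> bool" where
  "arith_fun f \<longleftrightarrow> arithmetical (\<lambda>\<rho>. \<rho> 0 = f (\<lambda>i. \<rho> (Suc i)))"

section \<open>Closure properties of arithmetical relations and functions\<close>

lemma arithmetical_eq_tm: "arithmetical (\<lambda>\<rho>. eval \<rho> t = eval \<rho> s)"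
  unfolding arithmetical_def by (rule exI[of _ "Eq t s"]) simp

lemma arithmetical_not: "arithmetical P \<Longrightarrow> arithmetical (\<lambda>\<rho>. \<not> P \<rho>)"
  unfolding arithmetical_def
proof safe
  fix \<phi> assume "negative \<phi>" "\<forall>\<rho>. sat \<rho> \<phi> = P \<rho>"
  then show "\<exists>\<phi>. negative \<phi> \<and> (\<forall>\<rho>. sat \<rho> \<phi> = (\<not> P \<rho>))"
    by (intro exI[of _ "Imp \<phi> Falsum"]) simp
qed

lemma arithmetical_conj:
  "arithmetical P \<Longrightarrow> arithmetical Q \<Longrightarrow> arithmetical (\<lambda>\<rho>. P \<rho> \<and> Q \<rho>)"
  unfolding arithmetical_def
proof safe
  fix \<phi> \<psi> assume "negative \<phi>" "\<forall>\<rho>. sat \<rho> \<phi> = P \<rho>" "negative \<psi>" "\<forall>\<rho>. sat \<rho> \<psi> = Q \<rho>"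
  then show "\<exists>\<phi>. negative \<phi> \<and> (\<forall>\<rho>. sat \<rho> \<phi> = (P \<rho> \<and> Q \<rho>))"
    by (intro exI[of _ "Conj \<phi> \<psi>"]) simp
qed

text \<open>De Morgan keeps the defining formula negative. Truth under \<open>sat\<close> is
  classical, so nothing is lost; existence is treated in the same way below.\<close>

lemma arithmetical_disj:
  assumes "arithmetical P" "arithmetical Q"
  shows "arithmetical (\<lambda>\<rho>. P \<rho> \<or> Q \<rho>)"
proof -
  have "arithmetical (\<lambda>\<rho>. \<not> (\<not> P \<rho> \<and> \<not> Q \<rho>))"
    by (intro arithmetical_not arithmetical_conj assms)
  then show ?thesis by simp
qed

lemma arithmetical_imp:
  "arithmetical P \<Longrightarrow> arithmetical Q \<Longrightarrow> arithmetical (\<lambda>\<rho>. P \<rho> \<longrightarrow> Q \<rho>)"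
  unfolding imp_conv_disj by (intro arithmetical_disj arithmetical_not)

lemma arithmetical_all:
  "arithmetical (\<lambda>\<rho>. Q (\<rho> 0) (\<lambda>i. \<rho> (Suc i))) \<Longrightarrow> arithmetical (\<lambda>\<rho>. \<forall>x. Q x \<rho>)"
  unfolding arithmetical_def
proof safe
  fix \<phi> assume "negative \<phi>" "\<forall>\<rho>. sat \<rho> \<phi> = Q (\<rho> 0) (\<lambda>i. \<rho> (Suc i))"
  then show "\<exists>\<phi>. negative \<phi> \<and> (\<forall>\<rho>. sat \<rho> \<phi> = (\<forall>x. Q x \<rho>))"
    by (intro exI[of _ "Forall \<phi>"]) simp
qed

lemma arithmetical_ex:
  assumes "arithmetical (\<lambda>\<rho>. Q (\<rho> 0) (\<lambda>i. \<rho> (Suc i)))"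
  shows "arithmetical (\<lambda>\<rho>. \<exists>x. Q x \<rho>)"
proof -
  have "arithmetical (\<lambda>\<rho>. \<not> (\<forall>x. \<not> Q x \<rho>))"
    by (intro arithmetical_not arithmetical_all assms)
  then show ?thesis by simp
qed

lemma arithmetical_rename:
  "arithmetical P \<Longrightarrow> arithmetical (\<lambda>\<rho>. P (\<lambda>i. \<rho> (\<sigma> i)))"
  unfolding arithmetical_def
proof safe
  fix \<phi> assume "negative \<phi>" "\<forall>\<rho>. sat \<rho> \<phi> = P \<rho>"
  then show "\<exists>\<phi>. negative \<phi> \<and> (\<forall>\<rho>. sat \<rho> \<phi> = P (\<lambda>i. \<rho> (\<sigma> i)))"
    by (intro exI[of _ "rename_fm \<sigma> \<phi>"]) (simp add: sat_rename_fm)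
qed

lemma arithmetical_eq:
  assumes "arith_fun f" "arith_fun g"
  shows "arithmetical (\<lambda>\<rho>. f \<rho> = g \<rho>)"
proof -
  have "arithmetical (\<lambda>\<rho>. \<exists>y. y = f \<rho> \<and> y = g \<rho>)"
    using assms unfolding arith_fun_def by (intro arithmetical_ex arithmetical_conj)
  then show ?thesis by simp
qed

lemma arith_fun_shift:
  assumes "arith_fun f"
  shows "arith_fun (\<lambda>\<rho>. f (\<lambda>i. \<rho> (Suc i)))"
  using arithmetical_rename[OF assms[unfolded arith_fun_def], of "case_nat 0 (\<lambda>i. Suc (Suc i))"]
  unfolding arith_fun_def by simp

lemma arithmetical_comp2:
  assumes "arithmetical (\<lambda>\<rho>. R (\<rho> 0) (\<rho> 1))" "arith_fun f" "arith_fun g"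
  shows "arithmetical (\<lambda>\<rho>. R (f \<rho>) (g \<rho>))"
proof -
  \<comment> \<open>The values of \<open>f\<close> and \<open>g\<close> need not be terms, so bound
    variables stand for them. Inside both quantifiers \<open>z\<close> is variable 0 and
    \<open>y\<close> is variable 1, whence the swap \<open>1 - i\<close>.\<close>
  have "arithmetical (\<lambda>\<rho>. \<exists>y z. y = f \<rho> \<and> z = g \<rho> \<and> R y z)"
    using assms(2) arith_fun_shift[OF assms(3)] arithmetical_rename[OF assms(1), of "\<lambda>i. 1 - i"]
      arithmetical_rename[OF assms(2)[unfolded arith_fun_def], of Suc]
    unfolding arith_fun_def
    by (intro arithmetical_ex arithmetical_conj) simp_all
  then show ?thesis by simp
qed

lemma arith_fun_var: "arith_fun (\<lambda>\<rho>. \<rho> k)"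
  using arithmetical_eq_tm[of "Var 0" "Var (Suc k)"] by (simp add: arith_fun_def)

lemma arith_fun_comp1:
  assumes "arith_fun (\<lambda>\<rho>. F (\<rho> 0))" "arith_fun f"
  shows "arith_fun (\<lambda>\<rho>. F (f \<rho>))"
proof -
  have "arithmetical (\<lambda>\<rho>. \<rho> 0 = F (\<rho> 1))"
    using assms(1) unfolding arith_fun_def by simp
  from arithmetical_comp2[OF this arith_fun_var[of 0] arith_fun_shift[OF assms(2)]]
  show ?thesis unfolding arith_fun_def by simp
qed

lemma arith_fun_comp2:
  assumes "arith_fun (\<lambda>\<rho>. F (\<rho> 0) (\<rho> 1))" "arith_fun f" "arith_fun g"
  shows "arith_fun (\<lambda>\<rho>. F (f \<rho>) (g \<rho>))"
proof -
  have "arithmetical (\<lambda>\<rho>. \<rho> 0 = F (\<rho> 1) (\<rho> 2))"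
    using assms(1) unfolding arith_fun_def by (simp add: numeral_2_eq_2)
  then have "arithmetical (\<lambda>\<rho>. \<rho> 2 = F (\<rho> 0) (\<rho> 1))"
    using arithmetical_rename[of "\<lambda>\<rho>. \<rho> 0 = F (\<rho> 1) (\<rho> 2)" "\<lambda>i. if i = 0 then 2 else i - 1"]
    by simp
  then have "arithmetical (\<lambda>\<rho>. \<exists>y z. y = g (\<lambda>i. \<rho> (Suc i)) \<and> z = f (\<lambda>i. \<rho> (Suc i)) \<and> \<rho> 0 = F z y)"
    using arith_fun_shift[OF arith_fun_shift[OF assms(2)]] arith_fun_shift[OF assms(3)]
      arithmetical_rename[OF arith_fun_shift[OF assms(3), unfolded arith_fun_def], of Suc]
    unfolding arith_fun_def
    by (intro arithmetical_ex arithmetical_conj) (simp_all add: numeral_2_eq_2)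
  then show ?thesis unfolding arith_fun_def by simp
qed

lemma arith_fun_eq_tm: "(\<And>\<rho>. f \<rho> = eval \<rho> t) \<Longrightarrow> arith_fun f"
  using arithmetical_eq_tm[of "Var 0" "rename_tm Suc t"]
  by (simp add: arith_fun_def eval_rename_tm)

lemma arith_fun_const: "arith_fun (\<lambda>\<rho>. c)"
  by (rule arith_fun_eq_tm[of _ "numeral_tm c"]) simp

lemma arith_fun_Suc: "arith_fun f \<Longrightarrow> arith_fun (\<lambda>\<rho>. Suc (f \<rho>))"
  by (erule arith_fun_comp1[rotated], rule arith_fun_eq_tm[of _ "Succ (Var 0)"]) simp

lemma arith_fun_add: "arith_fun f \<Longrightarrow> arith_fun g \<Longrightarrow> arith_fun (\<lambda>\<rho>. f \<rho> + g \<rho>)"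
  by (rule arith_fun_comp2, rule arith_fun_eq_tm[of _ "Plus (Var 0) (Var 1)"]) simp_all

lemma arith_fun_mult: "arith_fun f \<Longrightarrow> arith_fun g \<Longrightarrow> arith_fun (\<lambda>\<rho>. f \<rho> * g \<rho>)"
  by (rule arith_fun_comp2, rule arith_fun_eq_tm[of _ "Times (Var 0) (Var 1)"]) simp_all

lemma arithmetical_less:
  assumes "arith_fun f" "arith_fun g"
  shows "arithmetical (\<lambda>\<rho>. f \<rho> < g \<rho>)"
proof (rule arithmetical_comp2[OF _ assms])
  have "arithmetical (\<lambda>\<rho>. \<exists>d. \<rho> 1 = Suc (\<rho> 0 + d))"
    by (intro arithmetical_ex arithmetical_eq arith_fun_Suc arith_fun_add arith_fun_var)
  then show "arithmetical (\<lambda>\<rho>. \<rho> 0 < \<rho> 1)"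
    by (simp add: less_iff_Suc_add)
qed

lemma arith_fun_if:
  assumes "arithmetical P" "arith_fun f" "arith_fun g"
  shows "arith_fun (\<lambda>\<rho>. if P \<rho> then f \<rho> else g \<rho>)"
proof -
  have "arithmetical (\<lambda>\<rho>. P (\<lambda>i. \<rho> (Suc i)) \<and> \<rho> 0 = f (\<lambda>i. \<rho> (Suc i)) \<or>
    \<not> P (\<lambda>i. \<rho> (Suc i)) \<and> \<rho> 0 = g (\<lambda>i. \<rho> (Suc i)))"
    by (intro arithmetical_disj arithmetical_conj arithmetical_not
      arithmetical_rename[OF assms(1)] assms(2,3)[unfolded arith_fun_def])
  moreover have "(P (\<lambda>i. \<rho> (Suc i)) \<and> \<rho> 0 = f (\<lambda>i. \<rho> (Suc i)) \<or>
    \<not> P (\<lambda>i. \<rho> (Suc i)) \<and> \<rho> 0 = g (\<lambda>i. \<rho> (Suc i))) \<longleftrightarrow>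
    \<rho> 0 = (if P (\<lambda>i. \<rho> (Suc i)) then f (\<lambda>i. \<rho> (Suc i)) else g (\<lambda>i. \<rho> (Suc i)))" for \<rho> :: "nat \<Rightarrow> nat"
    by simp
  ultimately show ?thesis by (simp add: arith_fun_def)
qed

lemmas arith_intros =
  arithmetical_not arithmetical_conj arithmetical_disj arithmetical_imp arithmetical_all
  arithmetical_ex arithmetical_eq arithmetical_less
  arith_fun_var arith_fun_const arith_fun_Suc arith_fun_add arith_fun_mult arith_fun_if

lemma arith_fun_diff:
  assumes "arith_fun f" "arith_fun g"
  shows "arith_fun (\<lambda>\<rho>. f \<rho> - g \<rho>)"
proof (rule arith_fun_comp2[OF _ assms])
  have "arithmetical (\<lambda>\<rho>. \<rho> 1 = \<rho> 2 + \<rho> 0 \<or> (\<rho> 1 < \<rho> 2 \<and> \<rho> 0 = 0))"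
    by (intro arith_intros)
  moreover have "\<rho> 1 = \<rho> 2 + \<rho> 0 \<or> (\<rho> 1 < \<rho> 2 \<and> \<rho> 0 = 0) \<longleftrightarrow> \<rho> 0 = \<rho> 1 - \<rho> 2" for \<rho> :: "nat \<Rightarrow> nat"
    by auto
  ultimately show "arith_fun (\<lambda>\<rho>. \<rho> 0 - \<rho> 1)"
    by (simp add: arith_fun_def numeral_2_eq_2)
qed

lemma arith_fun_div:
  assumes "arith_fun f" "arith_fun g"
  shows "arith_fun (\<lambda>\<rho>. f \<rho> div g \<rho>)"
proof (rule arith_fun_comp2[OF _ assms])
  \<comment> \<open>Division by 0 gives 0, hence the first case.\<close>
  have "arithmetical (\<lambda>\<rho>. (\<rho> 2 = 0 \<and> \<rho> 0 = 0) \<or> (\<exists>r. r < \<rho> 2 \<and> \<rho> 1 = \<rho> 2 * \<rho> 0 + r))"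
    by (intro arith_intros)
  moreover have "(b = 0 \<and> y = 0) \<or> (\<exists>r. r < b \<and> a = b * y + r) \<longleftrightarrow> y = a div b" for a b y :: nat
    by (metis add.commute div_by_0 div_mult_mod_eq div_mult_self4 div_less add_0 mod_less_divisor mult.commute neq0_conv not_less0)
  ultimately show "arith_fun (\<lambda>\<rho>. \<rho> 0 div \<rho> 1)"
    by (simp add: arith_fun_def numeral_2_eq_2)
qed

lemma arith_fun_mod:
  assumes "arith_fun f" "arith_fun g"
  shows "arith_fun (\<lambda>\<rho>. f \<rho> mod g \<rho>)"
proof -
  have "arith_fun (\<lambda>\<rho>. f \<rho> - f \<rho> div g \<rho> * g \<rho>)"
    by (intro arith_fun_diff arith_fun_mult arith_fun_div assms)
  then show ?thesis by (simp add: minus_div_mult_eq_mod)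
qed

subsection \<open>Iteration\<close>

text \<open>Goedel's beta function, by which two numbers code a finite sequence of any
  length.\<close>

definition beta :: "nat \<Rightarrow> nat \<Rightarrow> nat \<Rightarrow> nat" where
  "beta a b i = a mod Suc (Suc i * b)"

text \<open>Chinese remainder theorem with \<open>b = N!\<close>, where \<open>N\<close> exceeds
  \<open>n\<close> and bounds all values. A common prime of two moduli divides
  \<open>(j - i) * b\<close>, and \<open>j - i\<close> divides \<open>N!\<close>; so the prime
  divides \<open>b\<close> and therefore 1. Since every value is at most \<open>b\<close>, it is its
  own residue.\<close>

lemma ex_beta: "\<exists>a b. \<forall>i\<le>n. beta a b i = f i"
proof -
  define N where "N = Max (insert (Suc n) (f ` {..n}))"
  have fN: "f i \<le> N" if "i \<le> n" for i
    unfolding N_def using that by (intro Max_ge) auto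
  have nN: "n < N"
    using Max_ge[of "insert (Suc n) (f ` {..n})" "Suc n"] unfolding N_def by simp
  define b where "b = (fact N :: nat)"
  have bN: "N \<le> b" unfolding b_def by (rule fact_ge_self)
  have cop: "coprime (Suc (Suc i * b)) (Suc (Suc j * b))" if "i < j" "j \<le> n" for i j
  proof (rule ccontr)
    assume "\<not> ?thesis"
    then obtain p where p: "prime p" "p dvd Suc (Suc i * b)" "p dvd Suc (Suc j * b)"
      using prime_factor_nat[of "gcd (Suc (Suc i * b)) (Suc (Suc j * b))"]
      by (auto simp: coprime_iff_gcd_eq_1)
    have "p dvd Suc (Suc j * b) - Suc (Suc i * b)"
      using p by (intro dvd_diff_nat)
    also have "Suc (Suc j * b) - Suc (Suc i * b) = (j - i) * b"
      by (simp add: diff_mult_distrib)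
    finally have "p dvd j - i \<or> p dvd b"
      using p(1) by (simp add: prime_dvd_mult_iff)
    moreover have "j - i dvd b"
      unfolding b_def using that nN by (intro dvd_fact) auto
    ultimately have "p dvd b" by (meson dvd_trans)
    then have "p dvd Suc i * b" by (rule dvd_mult)
    with p(2) have "p dvd 1"
      using dvd_diff_nat[of p "Suc (Suc i * b)" "Suc i * b"] by simp
    with p(1) show False by simp
  qed
  have "\<forall>i\<in>{..n}. \<forall>j\<in>{..n}. i \<noteq> j \<longrightarrow> coprime (Suc (Suc i * b)) (Suc (Suc j * b))"
    using cop by (metis atMost_iff coprime_commute linorder_neqE_nat)
  then obtain a where a: "\<forall>i\<in>{..n}. [a = f i] (mod Suc (Suc i * b))"
    using chinese_remainder_nat[of "{..n}" "\<lambda>i. Suc (Suc i * b)" f] by auto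
  have "beta a b i = f i" if "i \<le> n" for i
  proof -
    have "f i < Suc (Suc i * b)" using fN[OF that] bN by simp
    moreover have "a mod Suc (Suc i * b) = f i mod Suc (Suc i * b)"
      using a that unfolding cong_def by blast
    ultimately show ?thesis unfolding beta_def by simp
  qed
  then show ?thesis by blast
qed

text \<open>The beta function codes the whole orbit, so recursion turns into existence of
  \<open>a\<close> and \<open>b\<close>. For this reason the algorithms below are iterations of a
  single map on coded tuples.\<close>

lemma arith_fun_funpow:
  assumes S: "arith_fun (\<lambda>\<rho>. S (\<rho> 0))" and "arith_fun f" "arith_fun g"
  shows "arith_fun (\<lambda>\<rho>. (S ^^ f \<rho>) (g \<rho>))"
proof (rule arith_fun_comp2[of "\<lambda>k. S ^^ k", OF _ assms(2,3)])
  have "arithmetical (\<lambda>\<rho>. \<exists>a b. beta a b 0 = \<rho> 2 \<and> beta a b (\<rho> 1) = \<rho> 0 \<and>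
      (\<forall>i. i < \<rho> 1 \<longrightarrow> beta a b (Suc i) = S (beta a b i)))"
    unfolding beta_def
    by (intro arith_intros arith_fun_mod arith_fun_comp1[OF S])
  moreover have "(\<exists>a b. beta a b 0 = z \<and> beta a b k = y \<and>
      (\<forall>i. i < k \<longrightarrow> beta a b (Suc i) = S (beta a b i))) \<longleftrightarrow> y = (S ^^ k) z" (is "?L \<longleftrightarrow> _")
    for k y z
  proof
    assume ?L
    then obtain a b where ab: "beta a b 0 = z" "beta a b k = y"
      "\<forall>i<k. beta a b (Suc i) = S (beta a b i)" by blast
    have "i \<le> k \<Longrightarrow> beta a b i = (S ^^ i) z" for i
      by (induction i) (use ab in auto)
    then show "y = (S ^^ k) z" using ab by auto
  next
    assume y: "y = (S ^^ k) z"
    obtain a b where "\<forall>i\<le>k. beta a b i = (S ^^ i) z"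
      using ex_beta[of k "\<lambda>i. (S ^^ i) z"] by blast
    then show ?L using y by (intro exI[of _ a] exI[of _ b]) auto
  qed
  ultimately show "arith_fun (\<lambda>\<rho>. (S ^^ \<rho> 0) (\<rho> 1))"
    by (simp add: arith_fun_def numeral_2_eq_2)
qed

lemma arith_fun_power:
  assumes "arith_fun f"
  shows "arith_fun (\<lambda>\<rho>. c ^ f \<rho>)"
proof -
  have "((*) c ^^ k) 1 = c ^ k" for k
    by (induction k) auto
  moreover have "arith_fun (\<lambda>\<rho>. ((*) c ^^ f \<rho>) 1)"
    by (intro arith_fun_funpow arith_intros assms)
  ultimately show ?thesis by simp
qed

section \<open>Pairing\<close>

lemma arith_fun_prod_encode:
  assumes "arith_fun f" "arith_fun g"
  shows "arith_fun (\<lambda>\<rho>. prod_encode (f \<rho>, g \<rho>))"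
  unfolding prod_encode_def triangle_def prod.case
  by (intro arith_intros arith_fun_div assms)

abbreviation pfst :: "nat \<Rightarrow> nat" where "pfst z \<equiv> fst (prod_decode z)"
abbreviation psnd :: "nat \<Rightarrow> nat" where "psnd z \<equiv> snd (prod_decode z)"

lemma arith_fun_pfst:
  assumes "arith_fun f"
  shows "arith_fun (\<lambda>\<rho>. pfst (f \<rho>))"
proof (rule arith_fun_comp1[OF _ assms])
  have "arithmetical (\<lambda>\<rho>. \<exists>y. \<rho> 1 = prod_encode (\<rho> 0, y))"
    by (intro arith_intros arith_fun_prod_encode)
  moreover have "(\<exists>y. z = prod_encode (x, y)) \<longleftrightarrow> x = pfst z" for x z
    by (metis fst_conv prod.collapse prod_decode_inverse prod_encode_inverse)
  ultimately show "arith_fun (\<lambda>\<rho>. pfst (\<rho> 0))"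
    by (simp add: arith_fun_def)
qed

lemma arith_fun_psnd:
  assumes "arith_fun f"
  shows "arith_fun (\<lambda>\<rho>. psnd (f \<rho>))"
proof (rule arith_fun_comp1[OF _ assms])
  have "arithmetical (\<lambda>\<rho>. \<exists>y. \<rho> 1 = prod_encode (y, \<rho> 0))"
    by (intro arith_intros arith_fun_prod_encode)
  moreover have "(\<exists>y. z = prod_encode (y, x)) \<longleftrightarrow> x = psnd z" for x z
    by (metis snd_conv prod.collapse prod_decode_inverse prod_encode_inverse)
  ultimately show "arith_fun (\<lambda>\<rho>. psnd (\<rho> 0))"
    by (simp add: arith_fun_def)
qed

lemmas arith_fun_intros =
  arith_intros arith_fun_diff arith_fun_div arith_fun_mod arith_fun_power
  arith_fun_prod_encode arith_fun_pfst arith_fun_psnd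

section \<open>Computations are arithmetical\<close>

text \<open>Base 3 with digit 0 for the blank, so that the blanks beyond the end of a list do not matter.\<close>

fun tape_code :: "cell list \<Rightarrow> nat" where
  "tape_code [] = 0"
| "tape_code (x # xs) = symbol_index x + 3 * tape_code xs"

lemma symbol_index_less: "symbol_index s < 3"
  by (cases s rule: symbol_index.cases) auto

lemma tape_code_mod: "tape_code xs mod 3 = symbol_index (scan xs)"
  by (cases xs) (auto simp: symbol_index_less)

lemma tape_code_div: "tape_code xs div 3 = tape_code (tl xs)"
  by (cases xs) (auto simp: symbol_index_less)

text \<open>State: the number still to be read, the weight of the next ternary digit, the tape code
  so far. The step is the identity once the number is 0, so any sufficiently large number of
  iterations gives the same result.\<close>

definition input_step :: "nat \<Rightarrow> nat" where
  "input_step z = (if pfst z = 0 then z else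
     prod_encode ((pfst z - 1) div 2, prod_encode (3 * pfst (psnd z),
       psnd (psnd z) + pfst (psnd z) * Suc ((pfst z - 1) mod 2))))"

definition input_code :: "nat \<Rightarrow> nat" where
  "input_code n = psnd (psnd ((input_step ^^ n) (prod_encode (n, prod_encode (1, 0)))))"

lemma input_code: "input_code n = tape_code (map Some (bits_of_nat n))"
proof -
  have "psnd (psnd ((input_step ^^ k) (prod_encode (n, prod_encode (w, v))))) =
      v + w * tape_code (map Some (bits_of_nat n))" if "n \<le> k" for k n w v
    using that
  proof (induction k arbitrary: n w v)
    case (Suc k)
    show ?case
    proof (cases n)
      case 0
      then have "input_step (prod_encode (n, prod_encode (w, v))) = prod_encode (n, prod_encode (w, v))"
        by (simp add: input_step_def)
      with 0 Suc.IH[of n w v] show ?thesis by (simp add: funpow_Suc_right del: funpow.simps)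
    next
      case (Suc m)
      have "input_step (prod_encode (n, prod_encode (w, v))) =
          prod_encode (m div 2, prod_encode (3 * w, v + w * Suc (m mod 2)))"
        using Suc by (simp add: input_step_def)
      moreover have "m div 2 \<le> k" using Suc.prems Suc by simp
      moreover have "symbol_index (Some (odd m)) = Suc (m mod 2)"
        by (cases "odd m") (auto simp: odd_iff_mod_2_eq_one)
      ultimately show ?thesis
        using Suc Suc.IH[of "m div 2" "3 * w" "v + w * Suc (m mod 2)"]
        by (simp add: funpow_Suc_right algebra_simps del: funpow.simps symbol_index.simps)
    qed
  qed simp
  from this[of n n 1 0] show ?thesis by (simp add: input_code_def)
qed

text \<open>The ternary digits 1 and 2 of a tape are at the same time the digits of bijective base
  2, so reading the output is a change of base that stops at the first digit 0.\<close>

definition output_step :: "nat \<Rightarrow> nat" where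
  "output_step z = (if pfst z mod 3 = 0 then z else
     prod_encode (pfst z div 3, prod_encode (2 * pfst (psnd z),
       psnd (psnd z) + pfst (psnd z) * (pfst z mod 3))))"

definition output_value :: "nat \<Rightarrow> nat" where
  "output_value v = psnd (psnd ((output_step ^^ v) (prod_encode (v, prod_encode (1, 0)))))"

lemma output_value:
  "output_value (tape_code r) = nat_of_bits (map the (takeWhile (\<lambda>x. x \<noteq> None) r))"
proof -
  have "psnd (psnd ((output_step ^^ k) (prod_encode (tape_code r, prod_encode (w, v))))) =
      v + w * nat_of_bits (map the (takeWhile (\<lambda>x. x \<noteq> None) r))" if "tape_code r \<le> k" for k r w v
    using that
  proof (induction k arbitrary: r w v)
    case 0
    then show ?case by (cases r; cases "hd r" rule: symbol_index.cases) auto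
  next
    case (Suc k)
    show ?case
    proof (cases "scan r")
      case None
      then have "output_step (prod_encode (tape_code r, prod_encode (w, v))) =
          prod_encode (tape_code r, prod_encode (w, v))"
        by (simp add: output_step_def tape_code_mod)
      moreover from this have
        "(output_step ^^ j) (prod_encode (tape_code r, prod_encode (w, v))) =
          prod_encode (tape_code r, prod_encode (w, v))" for j
        by (induction j) simp_all
      moreover have "takeWhile (\<lambda>x. x \<noteq> None) r = []" using None by (cases r) auto
      ultimately show ?thesis by (simp del: funpow.simps)
    next
      case (Some b)
      then obtain xs where r: "r = Some b # xs" by (cases r) auto
      have "output_step (prod_encode (tape_code r, prod_encode (w, v))) =
          prod_encode (tape_code xs, prod_encode (2 * w, v + w * symbol_index (Some b)))"
        using tape_code_mod[of r] tape_code_div[of r] r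
        by (cases b) (simp_all add: output_step_def del: tape_code.simps)
      moreover have "tape_code xs \<le> k" using Suc.prems r by (cases b) auto
      moreover have "symbol_index (Some b) = Suc (of_bool b)" by (cases b) auto
      ultimately show ?thesis
        using r Suc.IH[of xs "2 * w" "v + w * symbol_index (Some b)"]
        by (simp add: funpow_Suc_right algebra_simps del: funpow.simps symbol_index.simps tape_code.simps)
    qed
  qed
  from this[of r "tape_code r" 1 0] show ?thesis by (simp add: output_value_def)
qed

text \<open>State: the rest of the code, the number of blocks still to be skipped, the length of the
  current block. A positive number is even iff its first bit is \<open>True\<close>. The step
  freezes at the \<open>False\<close> that ends the wanted block; so after enough steps a nonzero
  rest means success, and the result 0 is free to signal a missing entry.\<close>

definition entry_step :: "nat \<Rightarrow> nat" where
  "entry_step z = (if pfst z = 0 then z else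
     if pfst z mod 2 = 0 then
       prod_encode ((pfst z - 1) div 2, prod_encode (pfst (psnd z), Suc (psnd (psnd z))))
     else if pfst (psnd z) = 0 then z
     else prod_encode ((pfst z - 1) div 2, prod_encode (pfst (psnd z) - 1, 0)))"

definition entry_result :: "nat \<Rightarrow> nat" where
  "entry_result z = (if pfst z = 0 then 0 else Suc (psnd (psnd z)))"

definition entry_code :: "nat \<Rightarrow> nat \<Rightarrow> nat" where
  "entry_code e i = entry_result ((entry_step ^^ e) (prod_encode (e, prod_encode (i, 0))))"

lemma entry_code: "entry_code e i = (if i < length (table e) then Suc (table e ! i) else 0)"
proof -
  have "entry_result ((entry_step ^^ k) (prod_encode (e, prod_encode (i, a)))) =
      (if i < length (blocks a (bits_of_nat e)) then Suc (blocks a (bits_of_nat e) ! i) else 0)"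
    if "e \<le> k" for k e i a
    using that
  proof (induction k arbitrary: e i a)
    case 0
    then show ?case by (simp add: entry_result_def)
  next
    case (Suc k)
    let ?z = "prod_encode (e, prod_encode (i, a))"
    show ?case
    proof (cases "entry_step ?z = ?z")
      case True
      have "(entry_step ^^ j) ?z = ?z" for j
        by (induction j) (simp_all add: True)
      moreover have "e = 0 \<or> odd e \<and> i = 0"
        using True by (cases e) (auto simp: entry_step_def mod2_eq_if split: if_splits)
      ultimately show ?thesis
        by (cases e) (auto simp: entry_result_def simp del: funpow.simps)
    next
      case False
      then obtain m where m: "e = Suc m"
        by (cases e) (auto simp: entry_step_def)
      then have le: "m div 2 \<le> k" using Suc.prems by simp
      show ?thesis
      proof (cases "odd m")
        case True
        then have "entry_step ?z = prod_encode (m div 2, prod_encode (i, Suc a))"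
          using m by (simp add: entry_step_def)
        with Suc.IH[OF le] m True show ?thesis
          by (simp add: funpow_Suc_right del: funpow.simps)
      next
        case even: False
        then obtain j where j: "i = Suc j"
          using False m by (cases i) (auto simp: entry_step_def even_iff_mod_2_eq_zero mod_Suc)
        then have "entry_step ?z = prod_encode (m div 2, prod_encode (j, 0))"
          using m even by (simp add: entry_step_def mod_Suc even_iff_mod_2_eq_zero)
        with Suc.IH[OF le] m j even show ?thesis
          by (simp add: funpow_Suc_right del: funpow.simps)
      qed
    qed
  qed
  from this[of e e i 0] show ?thesis by (simp add: entry_code_def table_def)
qed

section \<open>Machine steps on codes\<close>

definition next_state :: "nat \<Rightarrow> nat \<Rightarrow> nat" where
  "next_state q a = (if a div 27 = 0 then Suc q else a div 27 - 1)"

definition next_left :: "nat \<Rightarrow> nat \<Rightarrow> nat \<Rightarrow> nat" where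
  "next_left d l r = (if d = 0 then l div 3 else if d = 1 then l else r mod 3 + 3 * l)"

definition next_right :: "nat \<Rightarrow> nat \<Rightarrow> nat \<Rightarrow> nat" where
  "next_right d l r = (if d = 0 then l mod 3 + 3 * r else if d = 1 then r else r div 3)"

definition act :: "nat \<Rightarrow> nat \<Rightarrow> nat \<Rightarrow> nat \<Rightarrow> nat" where
  "act a q l r = prod_encode (next_state q a, prod_encode
     (next_left (a div 3 mod 3) l (a mod 3 + 3 * (r div 3)),
      next_right (a div 3 mod 3) l (a mod 3 + 3 * (r div 3))))"

text \<open>The position of the oracle head is left out, since \<open>app\<close> runs on the zero
  oracle, where every position shows the same bit.\<close>

definition config_code :: "nat \<Rightarrow> nat \<Rightarrow> nat \<Rightarrow> nat \<Rightarrow> nat" where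
  "config_code e q l r = prod_encode (e, prod_encode (q, prod_encode (l, r)))"

definition config_entry :: "nat \<Rightarrow> nat" where
  "config_entry z = entry_code (pfst z) (6 * pfst (psnd z) + 2 * (psnd (psnd (psnd z)) mod 3))"

definition config_step :: "nat \<Rightarrow> nat" where
  "config_step z = (if config_entry z = 0 then z else
     prod_encode (pfst z, act (config_entry z - 1) (pfst (psnd z)) (pfst (psnd (psnd z))) (psnd (psnd (psnd z)))))"

definition run :: "nat \<Rightarrow> nat \<Rightarrow> nat \<Rightarrow> nat" where
  "run e n k = (config_step ^^ k) (config_code e 0 0 (input_code n))"

lemma config_entry_code:
  "config_entry (config_code e q l r) = entry_code e (6 * q + 2 * (r mod 3))"
  by (simp add: config_entry_def config_code_def)

lemma config_entry_eq_0:
  "config_entry (config_code e q l (tape_code r)) = 0 \<longleftrightarrow> step (\<lambda>_. False) (table e) (q, l', r, h) = None"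
  by (simp add: config_entry_code entry_code instr_def tape_code_mod Let_def split: prod.split)

lemma nth_symbol_index: "a < 3 \<Longrightarrow> symbol_index ([None, Some False, Some True] ! a) = a"
  by (auto simp: less_Suc_eq numeral_3_eq_3)

lemma config_step:
  assumes "step (\<lambda>_. False) (table e) (q, l, r, h) = Some (q', l', r', h')"
  shows "config_step (config_code e q (tape_code l) (tape_code r)) =
    config_code e q' (tape_code l') (tape_code r')"
proof -
  define i where "i = 6 * q + 2 * symbol_index (scan r)"
  have i: "i < length (table e)"
    using assms by (auto simp: instr_def i_def Let_def split: if_splits)
  define a where "a = table e ! i"
  have entry: "config_entry (config_code e q (tape_code l) (tape_code r)) = Suc a"
    using i by (simp add: config_entry_code entry_code tape_code_mod i_def a_def)
  have "instr (table e) q (scan r) False = Some (decode_instr q a)"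
    using i by (simp add: instr_def i_def a_def)
  moreover define s where "s = [None, Some False, Some True] ! (a mod 3)"
  moreover define d where "d = [MLeft, MStay, MRight] ! (a div 3 mod 3)"
  ultimately have q': "q' = next_state q a" and lr: "(l', r') = move_tape d (l, s # tl r)"
    using assms by (auto simp: decode_instr_def next_state_def split: prod.splits nat.splits)
  have s: "symbol_index s = a mod 3"
    by (simp add: s_def nth_symbol_index)
  have r1: "tape_code (s # tl r) = a mod 3 + 3 * (tape_code r div 3)"
    by (simp add: s tape_code_div)
  have "a div 3 mod 3 < 3" by simp
  then consider "a div 3 mod 3 = 0" | "a div 3 mod 3 = 1" | "a div 3 mod 3 = 2" by linarith
  then have "tape_code l' = next_left (a div 3 mod 3) (tape_code l) (tape_code (s # tl r)) \<and>
      tape_code r' = next_right (a div 3 mod 3) (tape_code l) (tape_code (s # tl r))"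
  proof cases
    case 1
    then show ?thesis using lr
      by (simp add: d_def next_left_def next_right_def tape_code_mod tape_code_div)
  next
    case 2
    then show ?thesis using lr
      by (simp add: d_def next_left_def next_right_def)
  next
    case 3
    then show ?thesis using lr tape_code_mod[of "s # tl r"] tape_code_div[of "s # tl r"]
      by (simp add: d_def next_left_def next_right_def del: tape_code.simps(2)) simp
  qed
  then show ?thesis
    using entry q' r1 by (simp add: config_step_def config_code_def act_def)
qed

text \<open>Halting is read off \<open>config_entry\<close> and not off a fixed point of
  \<open>config_step\<close>, which a looping machine may reach as well. Conversely halted
  configurations are fixed, so iterating beyond the end is harmless.\<close>

lemma halts_with_config:
  "halts_with (\<lambda>_. False) (table e) (q, l, r, h) m \<longleftrightarrow>
    (\<exists>k z. z = (config_step ^^ k) (config_code e q (tape_code l) (tape_code r)) \<and>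
      config_entry z = 0 \<and> output_value (psnd (psnd (psnd z))) = m)"
  (is "?L \<longleftrightarrow> ?R")
proof
  assume ?L
  then show ?R
  proof (induction "(q, l, r, h)" m arbitrary: q l r h rule: halts_with.induct)
    case (halt q l r h)
    let ?z = "config_code e q (tape_code l) (tape_code r)"
    have "config_entry ?z = 0"
      using halt config_entry_eq_0 by blast
    moreover have "output_value (psnd (psnd (psnd ?z))) = tape_output (q, l, r, h)"
      by (simp add: config_code_def output_value)
    ultimately have "?z = (config_step ^^ 0) ?z \<and> config_entry ?z = 0 \<and>
        output_value (psnd (psnd (psnd ?z))) = tape_output (q, l, r, h)"
      by simp
    then show ?case by blast
  next
    case (run c' n)
    obtain q' l' r' h' where c': "c' = (q', l', r', h')" by (cases c')
    from run(3)[OF c'] obtain k where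
      "config_entry ((config_step ^^ k) (config_code e q' (tape_code l') (tape_code r'))) = 0 \<and>
       output_value (psnd (psnd (psnd ((config_step ^^ k) (config_code e q' (tape_code l') (tape_code r')))))) = n"
      by blast
    then show ?case
      using config_step[OF run(1)[unfolded c']]
      by - (rule exI[of _ "Suc k"], simp add: funpow_Suc_right del: funpow.simps)
  qed
next
  assume ?R
  then obtain k where
    "config_entry ((config_step ^^ k) (config_code e q (tape_code l) (tape_code r))) = 0"
    "output_value (psnd (psnd (psnd ((config_step ^^ k) (config_code e q (tape_code l) (tape_code r)))))) = m"
    by blast
  then show ?L
  proof (induction k arbitrary: q l r h)
    case 0
    then have "halts_with (\<lambda>_. False) (table e) (q, l, r, h) (tape_output (q, l, r, h))"
      using config_entry_eq_0[of e q "tape_code l" r l h] by (intro halts_with.halt) simp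
    with 0 show ?case by (simp add: config_code_def output_value)
  next
    case (Suc k)
    show ?case
    proof (cases "step (\<lambda>_. False) (table e) (q, l, r, h)")
      case None
      let ?z = "config_code e q (tape_code l) (tape_code r)"
      have "config_entry ?z = 0"
        using config_entry_eq_0[of e q "tape_code l" r l h] None by simp
      then have "config_step ?z = ?z" by (simp add: config_step_def)
      then have "(config_step ^^ j) ?z = ?z" for j by (induction j) simp_all
      with Suc.prems have "output_value (psnd (psnd (psnd ?z))) = m" by (simp del: funpow.simps)
      with None show ?thesis
        using halts_with.halt[OF None] by (simp add: config_code_def output_value)
    next
      case (Some c')
      obtain q' l' r' h' where c': "c' = (q', l', r', h')" by (cases c')
      have "halts_with (\<lambda>_. False) (table e) (q', l', r', h') m"
        using Suc.prems config_step[OF Some[unfolded c']]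
        by (intro Suc.IH) (simp_all add: funpow_Suc_right del: funpow.simps)
      with Some c' show ?thesis by (metis halts_with.run)
    qed
  qed
qed

text \<open>Kleene's normal form: a single unbounded search, for the number of steps, around
  functions that are built by iteration.\<close>

lemma app_iff_run:
  "app e n m \<longleftrightarrow> (\<exists>k. config_entry (run e n k) = 0 \<and> output_value (psnd (psnd (psnd (run e n k)))) = m)"
  unfolding app_def computes_def init_config_def halts_with_config run_def input_code by simp

lemma arith_fun_input_code: "arith_fun f \<Longrightarrow> arith_fun (\<lambda>\<rho>. input_code (f \<rho>))"
  by (rule arith_fun_comp1) (unfold input_code_def input_step_def, intro arith_fun_intros arith_fun_funpow)

lemma arith_fun_output_value: "arith_fun f \<Longrightarrow> arith_fun (\<lambda>\<rho>. output_value (f \<rho>))"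
  by (rule arith_fun_comp1) (unfold output_value_def output_step_def, intro arith_fun_intros arith_fun_funpow)

lemma arith_fun_entry_code: "arith_fun f \<Longrightarrow> arith_fun g \<Longrightarrow> arith_fun (\<lambda>\<rho>. entry_code (f \<rho>) (g \<rho>))"
  by (rule arith_fun_comp2)
    (unfold entry_code_def entry_step_def entry_result_def, intro arith_fun_intros arith_fun_funpow)

lemma arith_fun_config_entry: "arith_fun f \<Longrightarrow> arith_fun (\<lambda>\<rho>. config_entry (f \<rho>))"
  unfolding config_entry_def by (intro arith_fun_intros arith_fun_entry_code)

lemma arith_fun_config_step: "arith_fun f \<Longrightarrow> arith_fun (\<lambda>\<rho>. config_step (f \<rho>))"
  unfolding config_step_def act_def next_state_def next_left_def next_right_def
  by (intro arith_fun_intros arith_fun_config_entry)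

lemma arith_fun_run:
  "arith_fun f \<Longrightarrow> arith_fun g \<Longrightarrow> arith_fun h \<Longrightarrow> arith_fun (\<lambda>\<rho>. run (f \<rho>) (g \<rho>) (h \<rho>))"
  unfolding run_def config_code_def
  by (intro arith_fun_funpow arith_fun_config_step arith_fun_intros arith_fun_input_code)

lemma arithmetical_app: "arithmetical (\<lambda>\<rho>. app (\<rho> i) (\<rho> j) (\<rho> k))"
  unfolding app_iff_run
  by (intro arith_fun_intros arith_fun_config_entry arith_fun_output_value arith_fun_run)

section \<open>Assembling machines\<close>

definition reach :: "(nat \<Rightarrow> bool) \<Rightarrow> nat list \<Rightarrow> config \<Rightarrow> config \<Rightarrow> bool" where
  "reach u T = (\<lambda>c c'. step u T c = Some c')\<^sup>*\<^sup>*"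

lemma reach_refl [simp]: "reach u T c c"
  by (simp add: reach_def)

lemma reach_step: "step u T c = Some c' \<Longrightarrow> reach u T c' c'' \<Longrightarrow> reach u T c c''"
  unfolding reach_def by (rule converse_rtranclp_into_rtranclp)

lemma reach_trans [trans]: "reach u T c c' \<Longrightarrow> reach u T c' c'' \<Longrightarrow> reach u T c c''"
  unfolding reach_def by (rule rtranclp_trans)

lemma reach_halts_with: "reach u T c c' \<Longrightarrow> halts_with u T c' n \<Longrightarrow> halts_with u T c n"
  unfolding reach_def by (induction rule: converse_rtranclp_induct) (auto intro: halts_with.run)

lemma reach_halt: "reach u T c c' \<Longrightarrow> step u T c' = None \<Longrightarrow> halts_with u T c (tape_output c')"
  by (blast intro: reach_halts_with halts_with.halt)

lemma tape_output_map_Some: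
  "tape_output (q, l, map Some bs, h) = nat_of_bits bs"
  "tape_output (q, l, map Some bs @ None # r, h) = nat_of_bits bs"
proof -
  have "takeWhile (\<lambda>x. x \<noteq> None) (map Some bs @ xs) = map Some bs @ takeWhile (\<lambda>x. x \<noteq> None) xs" for xs
    by (rule takeWhile_append2) auto
  note eq = this[of "[]", unfolded append_Nil2] this[of "None # r"]
  show "tape_output (q, l, map Some bs, h) = nat_of_bits bs"
    "tape_output (q, l, map Some bs @ None # r, h) = nat_of_bits bs"
    unfolding tape_output.simps eq by (simp_all add: o_def)
qed

text \<open>As in an entry of a table, next state \<open>0\<close> means the following state and \<open>Suc q\<close> means \<open>q\<close>.\<close>

type_synonym state = "cell \<Rightarrow> bool \<Rightarrow> instr"

fun move_index :: "move \<Rightarrow> nat" where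
  "move_index MLeft = 0"
| "move_index MStay = 1"
| "move_index MRight = 2"

fun entry :: "instr \<Rightarrow> nat" where
  "entry (s, m, m', x) = symbol_index s + 3 * move_index m + 9 * move_index m' + 27 * x"

fun resolve :: "nat \<Rightarrow> instr \<Rightarrow> instr" where
  "resolve q (s, m, m', 0) = (s, m, m', Suc q)"
| "resolve q (s, m, m', Suc q') = (s, m, m', q')"

lemma decode_entry: "decode_instr q (entry i) = resolve q i"
proof -
  obtain s m m' x where i: "i = (s, m, m', x)" by (cases i)
  have mod_div: "(i + 3 * j + 9 * k + 27 * x) mod 3 = i" "(i + 3 * j + 9 * k + 27 * x) div 3 mod 3 = j"
    "(i + 3 * j + 9 * k + 27 * x) div 9 mod 3 = k" "(i + 3 * j + 9 * k + 27 * x) div 27 = x"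
    if "i < 3" "j < 3" "k < 3" for i j k :: nat
  proof -
    have 3: "i + 3 * j + 9 * k + 27 * x = i + 3 * (j + 3 * (k + 3 * x))" by simp
    have d3: "(i + 3 * j + 9 * k + 27 * x) div 3 = j + 3 * (k + 3 * x)"
      using that unfolding 3 by simp
    have d9: "(i + 3 * j + 9 * k + 27 * x) div 9 = k + 3 * x"
      using that d3 div_mult2_eq[of "i + 3 * j + 9 * k + 27 * x" 3 3] by simp
    have "(i + 3 * j + 9 * k + 27 * x) div 27 = x"
      using that d9 div_mult2_eq[of "i + 3 * j + 9 * k + 27 * x" 9 3] by simp
    then show "(i + 3 * j + 9 * k + 27 * x) mod 3 = i" "(i + 3 * j + 9 * k + 27 * x) div 3 mod 3 = j"
      "(i + 3 * j + 9 * k + 27 * x) div 9 mod 3 = k" "(i + 3 * j + 9 * k + 27 * x) div 27 = x"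
      unfolding d3 d9 using that by (simp_all only: 3 mod_mult_self2 mod_less)
  qed
  have "symbol_index s < 3" "move_index m < 3" "move_index m' < 3"
    by (cases s rule: symbol_index.cases; cases m; cases m'; simp)+
  note eqs = mod_div[OF this]
  have "[None, Some False, Some True] ! symbol_index s = s"
    by (cases s rule: symbol_index.cases) auto
  moreover have "[MLeft, MStay, MRight] ! move_index k = k" for k
    by (cases k) auto
  ultimately show ?thesis
    unfolding decode_instr_def i entry.simps eqs by (cases x) simp_all
qed

text \<open>The order is that of the index \<open>2 * symbol_index s + of_bool b\<close> in
  \<open>instr\<close>.\<close>

definition state_entries :: "state \<Rightarrow> nat list" where
  "state_entries f = map entry
     [f None False, f None True, f (Some False) False, f (Some False) True, f (Some True) False, f (Some True) True]"

definition assemble :: "state list \<Rightarrow> nat list" where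
  "assemble fs = concat (map state_entries fs)"

lemma length_state_entries [simp]: "length (state_entries f) = 6"
  by (simp add: state_entries_def)

lemma assemble_Nil [simp]: "assemble [] = []"
  and assemble_Cons: "assemble (f # fs) = state_entries f @ assemble fs"
  and assemble_append: "assemble (fs @ gs) = assemble fs @ assemble gs"
  by (simp_all add: assemble_def)

lemma length_assemble [simp]: "length (assemble fs) = 6 * length fs"
  by (induction fs) (simp_all add: assemble_Cons)

lemma nth_assemble:
  "q < length fs \<Longrightarrow> assemble fs ! (6 * q + 2 * symbol_index s + of_bool b) = entry ((fs ! q) s b)"
proof (induction fs arbitrary: q)
  case (Cons f fs)
  have less: "2 * symbol_index s + of_bool b < 6"
    by (cases s rule: symbol_index.cases) auto
  show ?case
  proof (cases q)
    case 0
    have "state_entries f ! (2 * symbol_index s + of_bool b) = entry (f s b)"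
      by (cases s rule: symbol_index.cases; cases b) (simp_all add: state_entries_def eval_nat_numeral)
    then show ?thesis
      using 0 less by (simp add: assemble_Cons nth_append)
  next
    case (Suc p)
    then have "assemble fs ! (6 * p + 2 * symbol_index s + of_bool b) = entry ((fs ! p) s b)"
      using Cons by simp
    then show ?thesis
      using Suc by (simp add: assemble_Cons nth_append add.commute add.left_commute)
  qed
qed simp

text \<open>The tables printed by \<open>sampling_program\<close> below may be cut off in the middle of a state.\<close>

lemma instr_take_assemble:
  "instr (take i (assemble fs)) q s b =
    (if q < length fs \<and> 6 * q + 2 * symbol_index s + of_bool b < i
     then Some (resolve q ((fs ! q) s b))
     else None)"
proof (cases "q < length fs \<and> 6 * q + 2 * symbol_index s + of_bool b < i")
  case True
  have "2 * symbol_index s + of_bool b < 6"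
    by (cases s rule: symbol_index.cases) auto
  moreover have "6 * Suc q \<le> 6 * length fs" using True by simp
  ultimately have "6 * q + 2 * symbol_index s + of_bool b < 6 * length fs" by simp
  with True show ?thesis
    by (simp add: instr_def Let_def nth_assemble decode_entry)
next
  case False
  have "\<not> 6 * q + 2 * symbol_index s + of_bool b < min i (6 * length fs)"
    using False by auto
  with False show ?thesis by (simp add: instr_def Let_def)
qed

lemma instr_assemble:
  "instr (assemble fs) q s b =
    (if q < length fs
     then Some (resolve q ((fs ! q) s b))
     else None)"
proof -
  have "2 * symbol_index s + of_bool b < 6"
    by (cases s rule: symbol_index.cases) auto
  moreover have "6 * Suc q \<le> 6 * length fs" if "q < length fs" using that by simp
  ultimately have "6 * q + 2 * symbol_index s + of_bool b < 6 * length fs" if "q < length fs"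
    using that by simp
  then show ?thesis
    using instr_take_assemble[of "6 * length fs" fs q s b] by auto
qed

section \<open>Bit strings of tables, joined and cut off\<close>

definition table_bits :: "nat list \<Rightarrow> bool list" where
  "table_bits T = concat (map (\<lambda>a. replicate a True @ [False]) T)"

lemma table_bits_append: "table_bits (S @ T) = table_bits S @ table_bits T"
  by (simp add: table_bits_def)

lemma blocks_table_bits: "blocks 0 (table_bits T @ bs) = T @ blocks 0 bs"
  by (induction T) (auto simp: table_bits_def blocks_replicate)

lemma table_nat_of_bits: "table (nat_of_bits (table_bits T @ bs)) = T @ blocks 0 bs"
  by (simp add: table_def blocks_table_bits)

text \<open>An unterminated block is dropped, so cutting a code anywhere only removes entries from
  the end of the table. This is what makes inputs of arbitrary length harmless.\<close>

lemma blocks_take: "\<exists>i. blocks k (take j bs) = take i (blocks k bs)"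
proof (induction bs arbitrary: j k)
  case (Cons b bs)
  show ?case
  proof (cases j)
    case 0
    then show ?thesis by (auto intro: exI[of _ 0])
  next
    case (Suc j')
    show ?thesis
    proof (cases b)
      case True
      with Suc Cons show ?thesis by auto
    next
      case False
      obtain i where "blocks 0 (take j' bs) = take i (blocks 0 bs)" using Cons by blast
      with False Suc show ?thesis by (intro exI[of _ "Suc i"]) simp
    qed
  qed
qed simp

definition program :: "state list \<Rightarrow> nat" where
  "program fs = nat_of_bits (table_bits (assemble fs))"

lemma table_program [simp]: "table (program fs) = assemble fs"
  using table_nat_of_bits[of "assemble fs" "[]"] by (simp add: program_def)

lemma ordinary_program:
  "(\<And>f s. f \<in> set fs \<Longrightarrow> f s False = f s True) \<Longrightarrow> ordinary (program fs)"
  unfolding ordinary_def table_program by (metis instr_assemble nth_mem)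

subsection \<open>Writing a string\<close>

definition write_bit :: "bool \<Rightarrow> state" where
  "write_bit b = (\<lambda>_ _. (Some b, MLeft, MStay, 0))"

definition step_back :: state where
  "step_back = (\<lambda>_ _. (None, MRight, MStay, 0))"

text \<open>The string is written from right to left, its last symbol on the scanned cell.\<close>

definition write_string :: "bool list \<Rightarrow> state list" where
  "write_string w = map write_bit (rev w) @ [step_back]"

lemma length_write_string [simp]: "length (write_string w) = Suc (length w)"
  by (simp add: write_string_def)

lemma write_string_oblivious: "f \<in> set (write_string w) \<Longrightarrow> f s False = f s True"
  by (auto simp: write_string_def write_bit_def step_back_def)

text \<open>Allows a block of states to be verified once for every position in a table: the next
  state 0 is relative, and only explicit jumps are absolute.\<close>

definition executes :: "nat list \<Rightarrow> nat \<Rightarrow> state list \<Rightarrow> bool" where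
  "executes T p fs \<longleftrightarrow> (\<forall>q<length fs. \<forall>s b. instr T (p + q) s b =
     Some (resolve (p + q) ((fs ! q) s b)))"

lemma executes_assemble:
  "p = length fs \<Longrightarrow> executes (assemble (fs @ gs @ hs)) p gs"
  by (simp add: executes_def instr_assemble nth_append)

lemma executes_take_assemble:
  assumes "p = length fs" "6 * (length fs + length gs) \<le> i"
  shows "executes (take i (assemble (fs @ gs @ hs))) p gs"
proof -
  have "6 * (p + q) + 2 * symbol_index s + of_bool b < i" if "q < length gs" for q s b
  proof -
    have "2 * symbol_index s + of_bool b < 6"
      by (cases s rule: symbol_index.cases) auto
    with that assms show ?thesis by simp
  qed
  then show ?thesis
    using assms(1) by (simp add: executes_def instr_take_assemble nth_append)
qed

lemma executes_append:
  "executes T p (fs @ gs) \<longleftrightarrow> executes T p fs \<and> executes T (p + length fs) gs"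
proof safe
  assume "executes T p (fs @ gs)"
  then have H: "q < length (fs @ gs) \<Longrightarrow> instr T (p + q) s b =
    Some (resolve (p + q) (((fs @ gs) ! q) s b))"
    for q s b unfolding executes_def by blast
  show "executes T p fs"
    unfolding executes_def using H by (simp add: nth_append)
  show "executes T (p + length fs) gs"
    unfolding executes_def
  proof (intro allI impI)
    fix q s b assume "q < length gs"
    then show "instr T (p + length fs + q) s b = Some (resolve (p + length fs + q) ((gs ! q) s b))"
      using H[of "length fs + q" s b] by (simp add: nth_append add.assoc)
  qed
next
  assume H: "executes T p fs" "executes T (p + length fs) gs"
  show "executes T p (fs @ gs)"
    unfolding executes_def
  proof (intro allI impI)
    fix q s b assume q: "q < length (fs @ gs)"
    show "instr T (p + q) s b = Some (resolve (p + q) (((fs @ gs) ! q) s b))"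
    proof (cases "q < length fs")
      case True
      with H(1) show ?thesis by (simp add: executes_def nth_append)
    next
      case False
      with H(2) q show ?thesis
        unfolding executes_def
        by (auto simp: nth_append dest!: spec[of _ "q - length fs"])
    qed
  qed
qed

lemma executes_Cons:
  "executes T p (f # fs) \<longleftrightarrow>
    (\<forall>s b. instr T p s b = Some (resolve p (f s b))) \<and>
    executes T (Suc p) fs"
  using executes_append[of T p "[f]" fs] by (simp add: executes_def)

lemma executes_Nil [simp]: "executes T p []"
  by (simp add: executes_def)


text \<open>The scanned cell is always used up: it receives the last symbol or, for the empty
  string, is stepped over; hence \<open>tl r\<close>. What remains on the left is never read again
  and stays unspecified.\<close>

lemma reach_write_string:
  assumes "executes T p (write_string w)"
  shows "\<exists>l'. reach u T (p, l, r, h) (p + Suc (length w), l', map Some w @ tl r, h)"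
  using assms
proof (induction w arbitrary: p l r rule: rev_induct)
  case Nil
  then have "step u T (p, l, r, h) = Some (Suc p, None # l, tl r, h)"
    by (simp add: write_string_def executes_Cons step_back_def)
  from reach_step[OF this reach_refl] show ?case by auto
next
  case (snoc b w)
  from snoc.prems have "step u T (p, l, r, h) = Some (Suc p, tl l, scan l # Some b # tl r, h)"
    and ex: "executes T (Suc p) (write_string w)"
    by (simp_all add: write_string_def executes_Cons write_bit_def)
  moreover from snoc.IH[OF ex, of "tl l" "scan l # Some b # tl r"]
  obtain l' where "reach u T (Suc p, tl l, scan l # Some b # tl r, h)
      (Suc p + Suc (length w), l', map Some w @ tl (scan l # Some b # tl r), h)" by blast
  ultimately have "reach u T (p, l, r, h)
      (Suc p + Suc (length w), l', map Some w @ tl (scan l # Some b # tl r), h)"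
    by (blast intro: reach_step)
  then show ?case by auto
qed

subsection \<open>Constant programs\<close>

text \<open>The value \<open>1\<close> is a jump to state 0, so this has to be the first state of
  its program.\<close>

definition erase :: state where
  "erase = (\<lambda>s _. if s = None then (None, MStay, MStay, 0) else (None, MRight, MStay, 1))"

definition const_program :: "nat \<Rightarrow> nat" where
  "const_program c = program (erase # write_string (bits_of_nat c))"

lemma ordinary_const_program: "ordinary (const_program c)"
  unfolding const_program_def
  by (rule ordinary_program) (auto simp: erase_def write_string_oblivious)

lemma computes_const_program: "computes u (const_program c) n c"
proof -
  let ?T = "assemble (erase # write_string (bits_of_nat c))"
  have "executes ?T 0 (erase # write_string (bits_of_nat c))"
    using executes_assemble[of 0 "[]" "erase # write_string (bits_of_nat c)" "[]"] by simp
  then have "instr ?T 0 = (\<lambda>s b. Some (resolve 0 (erase s b)))"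
    and wr: "executes ?T (Suc 0) (write_string (bits_of_nat c))"
    by (auto simp: executes_Cons)
  then have instr0: "instr ?T 0 s b =
      Some (if s = None then (None, MStay, MStay, 1) else (None, MRight, MStay, 0))" for s b
    by (simp add: erase_def)
  have erase: "\<exists>l'. reach u ?T (0, l, map Some xs, 0) (Suc 0, l', [None], 0)" for l xs
  proof (induction xs arbitrary: l)
    case Nil
    have "step u ?T (0, l, [], 0) = Some (Suc 0, l, [None], 0)"
      by (simp add: instr0)
    from reach_step[OF this reach_refl] show ?case by auto
  next
    case (Cons x xs)
    have "step u ?T (0, l, map Some (x # xs), 0) = Some (0, None # l, map Some xs, 0)"
      by (simp add: instr0)
    with Cons[of "None # l"] show ?case by (blast intro: reach_step)
  qed
  obtain l1 where l1: "reach u ?T (init_config n) (Suc 0, l1, [None], 0)"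
    using erase unfolding init_config_def by blast
  obtain l2 where l2: "reach u ?T (Suc 0, l1, [None], 0)
      (Suc 0 + Suc (length (bits_of_nat c)), l2, map Some (bits_of_nat c) @ tl [None], 0)" (is "reach _ _ _ ?c")
    using reach_write_string[OF wr] by blast
  have "step u ?T ?c = None"
    by (simp add: instr_assemble)
  from reach_halt[OF reach_trans[OF l1 l2] this]
  show ?thesis
    by (simp add: computes_def const_program_def tape_output_map_Some del: tape_output.simps)
qed

lemma app_const_program: "app (const_program c) n c"
  by (simp add: app_def computes_const_program)

text \<open>Constant programs are what a sampling machine has to return on input 0. Their codes
  survive its copiers because these idle on a scanned \<open>True\<close>.\<close>

lemma hd_bits_const_program: "\<exists>bs. bits_of_nat (const_program c) = True # bs"
proof -
  \<comment> \<open>The entry \<open>12\<close> says that a blank stays unchanged and that neither head moves.\<close>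
  obtain T where "assemble (erase # write_string (bits_of_nat c)) = Suc 11 # T"
    by (simp add: assemble_Cons state_entries_def erase_def)
  then show ?thesis
    unfolding const_program_def program_def by (simp only: table_bits_def list.map concat.simps replicate_Suc append_Cons bits_of_nat_of_bits) simp
qed

subsection \<open>Sampling the oracle\<close>

definition copy_bit :: state where
  "copy_bit s b = (case s of
     None \<Rightarrow> (None, MStay, MStay, 0)
   | Some True \<Rightarrow> (Some True, MStay, MStay, 0)
   | Some False \<Rightarrow> (Some b, MLeft, MRight, 0))"

definition put_mark :: state where
  "put_mark s b = (if s = None then Some False else s, MStay, MStay, 0)"

text \<open>
  A copier on a scanned \<open>False\<close>, to the left of which the tape is blank, replaces it by an oracle bit
  and puts a new \<open>False\<close> to its left. On a scanned \<open>True\<close> it idles. So the scanned symbol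
  distinguishes the inputs \<open>0\<close> and \<open>1\<close> although the machine has to pass through all its copiers on
  both of them.
\<close>

definition copiers :: "nat \<Rightarrow> state list" where
  "copiers N = concat (replicate N [copy_bit, put_mark])"

text \<open>Input 0 is the empty tape, and input 1 is the single digit \<open>False\<close>, which
  already is the mark from which the first copier starts.\<close>

definition dispatch :: "nat \<Rightarrow> state" where
  "dispatch q = (\<lambda>s _. if s = None then (None, MStay, MStay, 0) else (s, MStay, MStay, Suc q))"

text \<open>The copiers come last so that more of them can be appended to a finished code.\<close>

definition sampler :: "nat \<Rightarrow> nat \<Rightarrow> state list" where
  "sampler c N = (dispatch (length (bits_of_nat c) + 2) # write_string (bits_of_nat c)) @ copiers N"

lemma copiers_Suc: "copiers (Suc N) = copiers N @ [copy_bit, put_mark]"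
  by (simp add: copiers_def flip: replicate_append_same)

lemma copiers_add: "copiers (M + N) = copiers M @ copiers N"
  by (simp add: copiers_def replicate_add)

lemma length_copiers [simp]: "length (copiers N) = 2 * N"
  by (induction N) (auto simp: copiers_Suc copiers_def)

lemma nth_sampler:
  assumes "length (bits_of_nat c) + 2 \<le> q" "q < length (sampler c N)"
  shows "sampler c N ! q = copy_bit \<or> sampler c N ! q = put_mark"
proof -
  have "set (copiers N) \<subseteq> {copy_bit, put_mark}"
    by (auto simp: copiers_def)
  moreover have "sampler c N ! q = copiers N ! (q - (length (bits_of_nat c) + 2))"
    "q - (length (bits_of_nat c) + 2) < length (copiers N)"
    using assms by (auto simp: sampler_def nth_append nth_Cons split: nat.split)
  ultimately show ?thesis
    using nth_mem[of "q - (length (bits_of_nat c) + 2)" "copiers N"] by (metis insert_iff singletonD subsetD)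
qed

lemma step_sampler:
  assumes "length (bits_of_nat c) + 2 \<le> q"
    and "step u (take i (assemble (sampler c N))) (q, l, r, h) = Some (q', l', r', h')"
  shows "q' = Suc q" "q < length (sampler c N)"
    "scan r = Some True \<Longrightarrow> takeWhile (\<lambda>x. x \<noteq> None) r' = takeWhile (\<lambda>x. x \<noteq> None) r \<and> scan r' = Some True"
proof -
  show q: "q < length (sampler c N)"
    using assms(2) by (auto simp: instr_take_assemble split: if_splits)
  have instr: "instr (take i (assemble (sampler c N))) q (scan r) (u h) =
      Some (resolve q ((sampler c N ! q) (scan r) (u h)))"
    using assms(2) by (auto simp: instr_take_assemble split: if_splits)
  have step: "Some (q', l', r', h') = (case resolve q ((sampler c N ! q) (scan r) (u h)) of (s, m, m', q') \<Rightarrow>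
      (let (l', r') = move_tape m (l, s # tl r) in Some (q', l', r', move_oracle m' h)))"
    using assms(2) unfolding step.simps instr by simp
  note f = nth_sampler[OF assms(1) q]
  show "q' = Suc q"
    using step f by (cases "scan r" rule: symbol_index.cases) (auto simp: copy_bit_def put_mark_def)
  assume "scan r = Some True"
  then obtain xs where "r = Some True # xs" by (cases r) auto
  with step f
  show "takeWhile (\<lambda>x. x \<noteq> None) r' = takeWhile (\<lambda>x. x \<noteq> None) r \<and> scan r' = Some True"
    by (auto simp: copy_bit_def put_mark_def)
qed

text \<open>Without jumps the state number grows until the table ends, wherever it was cut off and
  whatever the oracle is. Along the way a scanned \<open>True\<close> keeps the output
  fixed.\<close>

lemma sampler_halts:
  assumes "length (bits_of_nat c) + 2 \<le> q"
  shows "\<exists>x. halts_with u (take i (assemble (sampler c N))) (q, l, r, h) x \<and>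
    (scan r = Some True \<longrightarrow> x = tape_output (q, l, r, h))"
  using assms
proof (induction "length (sampler c N) - q" arbitrary: q l r h rule: less_induct)
  case less
  let ?T = "take i (assemble (sampler c N))"
  show ?case
  proof (cases "step u ?T (q, l, r, h)")
    case None
    from halts_with.halt[OF this] show ?thesis by blast
  next
    case (Some d)
    obtain q' l' r' h' where d: "d = (q', l', r', h')" by (cases d)
    note step = step_sampler[OF less.prems Some[unfolded d]]
    have "length (sampler c N) - q' < length (sampler c N) - q" "length (bits_of_nat c) + 2 \<le> q'"
      using step(1,2) less.prems by auto
    from less.hyps[OF this, of l' r' h'] obtain x where
      x: "halts_with u ?T d x" "scan r' = Some True \<longrightarrow> x = tape_output d"
      unfolding d by blast
    then have "scan r = Some True \<longrightarrow> x = tape_output (q, l, r, h)"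
      using step(3) by (auto simp: d)
    with halts_with.run[OF Some x(1)] show ?thesis by blast
  qed
qed

lemma executes_sampler:
  assumes "6 * (length (bits_of_nat c) + 2) \<le> i"
  shows "executes (take i (assemble (sampler c N))) 0
    (dispatch (length (bits_of_nat c) + 2) # write_string (bits_of_nat c))"
  unfolding sampler_def
  using assms executes_take_assemble[of 0 "[]"
      "dispatch (length (bits_of_nat c) + 2) # write_string (bits_of_nat c)" i "copiers N"]
  by simp

lemma sampler_0:
  assumes i: "6 * (length (bits_of_nat c) + 2) \<le> i" and c: "bits_of_nat c = True # bs"
  shows "halts_with u (take i (assemble (sampler c N))) (init_config 0) c"
proof -
  let ?T = "take i (assemble (sampler c N))"
  let ?n = "length (bits_of_nat c)"
  have first: "instr ?T 0 None b = Some (None, MStay, MStay, 1)" for b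
    using executes_sampler[OF i, of N] by (auto simp: executes_Cons dispatch_def)
  have wr: "executes ?T (Suc 0) (write_string (bits_of_nat c))"
    using executes_sampler[OF i, of N] by (auto simp: executes_Cons dispatch_def)
  have "step u ?T (init_config 0) = Some (Suc 0, [], [None], 0)"
    by (simp add: init_config_def first)
  moreover obtain l' where "reach u ?T (Suc 0, [], [None], 0)
      (Suc 0 + Suc ?n, l', map Some (bits_of_nat c) @ tl [None], 0)"
    using reach_write_string[OF wr] by blast
  ultimately have reach: "reach u ?T (init_config 0) (?n + 2, l', map Some (bits_of_nat c), 0)"
    by (simp add: reach_step del: step.simps)
  have "scan (map Some (bits_of_nat c)) = Some True"
    by (simp add: c)
  moreover have "tape_output (?n + 2, l', map Some (bits_of_nat c), 0) = c"
    by (simp add: tape_output_map_Some del: tape_output.simps)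
  ultimately have "halts_with u ?T (?n + 2, l', map Some (bits_of_nat c), 0) c"
    using sampler_halts[of c "?n + 2" u i N l' "map Some (bits_of_nat c)" 0] by auto
  with reach show ?thesis by (rule reach_halts_with)
qed

lemma step_sampler_1:
  assumes i: "6 * (length (bits_of_nat c) + 2) \<le> i"
  shows "step u (take i (assemble (sampler c N))) (init_config 1) =
    Some (length (bits_of_nat c) + 2, [], [Some False], 0)"
proof -
  have "instr (take i (assemble (sampler c N))) 0 (Some False) b =
      Some (Some False, MStay, MStay, length (bits_of_nat c) + 2)" for b
    using executes_sampler[OF i, of N] by (auto simp: executes_Cons dispatch_def)
  then show ?thesis by (simp add: init_config_def)
qed

text \<open>Termination is all that a cut table has to provide on input 1: where no program is
  diagonalised against, every value is a correct witness.\<close>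

lemma sampler_1_halts:
  assumes "6 * (length (bits_of_nat c) + 2) \<le> i"
  shows "\<exists>x. halts_with u (take i (assemble (sampler c N))) (init_config 1) x"
  using sampler_halts[of c "length (bits_of_nat c) + 2"] halts_with.run[OF step_sampler_1[OF assms]]
  by blast

text \<open>Each round inserts the next bit between the mark and the earlier bits, so the sample
  appears in reverse.\<close>

lemma reach_copiers:
  assumes "executes T p (copiers N)"
  shows "reach u T (p, [], [Some False], 0)
    (p + 2 * N, [], Some False # map Some (rev (map u [0..<N])), N)"
  using assms
proof (induction N)
  case (Suc N)
  let ?r = "map Some (rev (map u [0..<N]))"
  from Suc.prems have ex: "executes T p (copiers N)" "executes T (p + 2 * N) [copy_bit, put_mark]"
    by (simp_all add: copiers_Suc executes_append)
  note Suc.IH[OF ex(1)]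
  also have "reach u T (p + 2 * N, [], Some False # ?r, N) (Suc (p + 2 * N), [], None # Some (u N) # ?r, Suc N)"
    using ex(2) by (intro reach_step[OF _ reach_refl]) (simp add: executes_Cons copy_bit_def)
  also have "reach u T (Suc (p + 2 * N), [], None # Some (u N) # ?r, Suc N)
      (Suc (Suc (p + 2 * N)), [], Some False # Some (u N) # ?r, Suc N)"
    using ex(2) by (intro reach_step[OF _ reach_refl]) (simp add: executes_Cons put_mark_def)
  finally show ?case by simp
qed simp

lemma sampler_1:
  "halts_with u (assemble (sampler c N)) (init_config 1) (nat_of_bits (False # rev (map u [0..<N])))"
proof -
  let ?p = "length (bits_of_nat c) + 2"
  let ?T = "assemble (sampler c N)"
  let ?c = "(?p + 2 * N, [], Some False # map Some (rev (map u [0..<N])), N)"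
  have len: "length (sampler c N) = ?p + 2 * N"
    by (simp add: sampler_def)
  have "step u ?T (init_config 1) = Some (?p, [], [Some False], 0)"
    using step_sampler_1[of c "6 * length (sampler c N)" u N] len by simp
  moreover have "executes ?T ?p (copiers N)"
    unfolding sampler_def
    using executes_assemble[of ?p "dispatch ?p # write_string (bits_of_nat c)" "copiers N" "[]"] by simp
  ultimately have "reach u ?T (init_config 1) ?c"
    using reach_copiers by (blast intro: reach_step)
  moreover have "step u ?T ?c = None"
    by (simp add: instr_assemble len)
  ultimately have "halts_with u ?T (init_config 1) (tape_output ?c)"
    by (rule reach_halt)
  then show ?thesis
    using tape_output_map_Some(1)[of _ _ "False # rev (map u [0..<N])"]
    by (simp del: tape_output.simps)
qed

subsection \<open>Overwriting the input by a periodic string\<close>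

definition cycle :: "bool list \<Rightarrow> nat \<Rightarrow> bool list" where
  "cycle bs n = map (\<lambda>j. bs ! (j mod length bs)) [0..<n]"

lemma cycle_Suc: "cycle bs (Suc n) = cycle bs n @ [bs ! (n mod length bs)]"
  by (simp add: cycle_def)

lemma cycle_mult: "cycle bs (length bs * e) = concat (replicate e bs)"
proof (induction e)
  case (Suc e)
  have "[0..<length bs * Suc e] = [0..<length bs * e] @ map (\<lambda>j. j + length bs * e) [0..<length bs]"
    using upt_add_eq_append[of 0 "length bs * e" "length bs"]
    by (simp add: map_add_upt add.commute)
  then have "cycle bs (length bs * Suc e) = cycle bs (length bs * e) @ map (\<lambda>j. bs ! j) [0..<length bs]"
    by (simp add: cycle_def o_def)
  with Suc show ?case
    by (simp add: map_nth flip: replicate_append_same)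
qed (simp add: cycle_def)

lemma cycle_take:
  assumes "bs \<noteq> []"
  shows "cycle bs n = take n (concat (replicate n bs))"
proof -
  have "n \<le> length bs * n" using assms by (cases bs) auto
  then have "cycle bs n = take n (cycle bs (length bs * n))"
    by (simp add: cycle_def take_map)
  then show ?thesis by (simp only: cycle_mult)
qed

text \<open>The state counts modulo \<open>length bs\<close>, so a finite machine can lay down the
  period over an input of any length.\<close>

definition fill :: "bool list \<Rightarrow> nat \<Rightarrow> state" where
  "fill bs j = (\<lambda>s _. if s = None then (None, MLeft, MStay, Suc (length bs))
     else (Some (bs ! j), MRight, MStay, if Suc j = length bs then 1 else 0))"

definition rewind :: "nat \<Rightarrow> state" where
  "rewind q = (\<lambda>s _. if s = None then (None, MStay, MStay, 0) else (s, MLeft, MStay, Suc q))"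

text \<open>Rewinding stops on the blank just before the string. That is the cell on which
  \<open>write_string\<close> puts its last symbol, so \<open>w\<close> joins the periodic part
  without a gap.\<close>

definition filler :: "bool list \<Rightarrow> bool list \<Rightarrow> state list" where
  "filler bs w = map (fill bs) [0..<length bs] @ rewind (length bs) # write_string w"

lemma computes_filler:
  assumes "bs \<noteq> []"
  shows "computes u (program (filler bs w)) n (nat_of_bits (w @ cycle bs (length (bits_of_nat n))))"
proof -
  let ?m = "length bs"
  let ?T = "assemble (filler bs w)"
  let ?L = "length (bits_of_nat n)"
  have mod: "k mod ?m < ?m" for k using assms by simp
  have instr_fill: "instr ?T (k mod ?m) s b = Some (if s = None then (None, MLeft, MStay, ?m)
      else (Some (bs ! (k mod ?m)), MRight, MStay, Suc k mod ?m))" for k s b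
  proof -
    have "filler bs w ! (k mod ?m) = fill bs (k mod ?m)" "k mod ?m < length (filler bs w)"
      using mod[of k] by (simp_all add: filler_def nth_append)
    then show ?thesis
      using mod[of k] by (simp add: instr_assemble fill_def mod_Suc)
  qed
  have tail: "executes ?T ?m (rewind ?m # write_string w)"
    using executes_assemble[of ?m "map (fill bs) [0..<?m]" "rewind ?m # write_string w" "[]"]
    by (simp add: filler_def)
  then have instr_rewind: "instr ?T ?m s b =
      Some (if s = None then (None, MStay, MStay, Suc ?m) else (s, MLeft, MStay, ?m))" for s b
    by (simp add: executes_Cons rewind_def)
  have wr: "executes ?T (Suc ?m) (write_string w)"
    using tail by (simp add: executes_Cons)
  have filling: "reach u ?T (k mod ?m, map Some (rev (cycle bs k)), map Some xs, 0)
      ((k + length xs) mod ?m, map Some (rev (cycle bs (k + length xs))), [], 0)" for k xs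
  proof (induction xs arbitrary: k)
    case (Cons x xs)
    have "step u ?T (k mod ?m, map Some (rev (cycle bs k)), map Some (x # xs), 0) =
        Some (Suc k mod ?m, map Some (rev (cycle bs (Suc k))), map Some xs, 0)"
      by (simp add: instr_fill cycle_Suc)
    from reach_step[OF this Cons[of "Suc k"]] show ?case by simp
  qed simp
  have rewinding: "reach u ?T (?m, map Some zs, Some z # r, 0) (?m, [], None # map Some (rev zs) @ Some z # r, 0)"
    for zs z r
  proof (induction zs arbitrary: z r)
    case Nil
    show ?case
      by (rule reach_step[OF _ reach_refl]) (simp add: instr_rewind)
  next
    case (Cons y zs)
    have "step u ?T (?m, map Some (y # zs), Some z # r, 0) = Some (?m, map Some zs, Some y # Some z # r, 0)"
      by (simp add: instr_rewind)
    from reach_step[OF this Cons[of y "Some z # r"]] show ?case by simp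
  qed
  let ?c = "cycle bs ?L"
  have "init_config n = (0 mod ?m, map Some (rev (cycle bs 0)), map Some (bits_of_nat n), 0)"
    by (simp add: init_config_def cycle_def)
  then have "reach u ?T (init_config n) (?L mod ?m, map Some (rev ?c), [], 0)"
    using filling[of 0 "bits_of_nat n"] by simp
  also have "reach u ?T (?L mod ?m, map Some (rev ?c), [], 0) (?m, [], None # map Some ?c @ [None], 0)"
  proof (cases "rev ?c")
    case Nil
    then show ?thesis
      by (intro reach_step[OF _ reach_refl]) (simp add: instr_fill)
  next
    case (Cons z zs)
    then have c: "?c = rev zs @ [z]" by (simp add: rev_swap)
    have "step u ?T (?L mod ?m, map Some (rev ?c), [], 0) = Some (?m, map Some zs, [Some z, None], 0)"
      by (simp add: instr_fill Cons)
    from reach_step[OF this rewinding] show ?thesis by (simp add: c)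
  qed
  also have "reach u ?T (?m, [], None # map Some ?c @ [None], 0) (Suc ?m, [], None # map Some ?c @ [None], 0)"
    by (intro reach_step[OF _ reach_refl]) (simp add: instr_rewind)
  finally have "reach u ?T (init_config n) (Suc ?m, [], None # map Some ?c @ [None], 0)" .
  moreover obtain l' where "reach u ?T (Suc ?m, [], None # map Some ?c @ [None], 0)
      (Suc ?m + Suc (length w), l', map Some w @ tl (None # map Some ?c @ [None]), 0)" (is "reach _ _ _ ?d")
    using reach_write_string[OF wr] by blast
  ultimately have "reach u ?T (init_config n) ?d" by (rule reach_trans)
  moreover have "step u ?T ?d = None"
    by (simp add: instr_assemble filler_def)
  ultimately have "halts_with u ?T (init_config n) (tape_output ?d)"
    by (rule reach_halt)
  moreover have "tape_output ?d = nat_of_bits (w @ ?c)"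
    using tape_output_map_Some(2)[of _ _ "w @ ?c" "[]"] by (simp del: tape_output.simps)
  ultimately show ?thesis by (simp add: computes_def)
qed

definition copier_bits :: "bool list" where
  "copier_bits = table_bits (assemble [copy_bit, put_mark])"

text \<open>A fixed header followed by the overwritten input: each full period extends the table by
  one copier, and an incomplete last period merely truncates it.\<close>

definition sampler_code :: "nat \<Rightarrow> nat \<Rightarrow> nat \<Rightarrow> nat" where
  "sampler_code k c L = nat_of_bits (table_bits (assemble (sampler c k)) @ cycle copier_bits L)"

definition sampling_program :: "nat \<Rightarrow> nat \<Rightarrow> nat" where
  "sampling_program k c = program (filler copier_bits (table_bits (assemble (sampler c k))))"

lemma copier_bits_nonempty: "copier_bits \<noteq> []"
  by (simp add: copier_bits_def assemble_Cons state_entries_def table_bits_def)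

lemma computes_sampling_program:
  "computes u (sampling_program k c) n (sampler_code k c (length (bits_of_nat n)))"
  unfolding sampling_program_def sampler_code_def
  by (rule computes_filler[OF copier_bits_nonempty])

lemma concat_copier_bits: "concat (replicate e copier_bits) = table_bits (assemble (copiers e))"
proof (induction e)
  case 0
  then show ?case by (simp add: copiers_def table_bits_def)
next
  case (Suc e)
  have "concat (replicate (Suc e) copier_bits) = concat (replicate e copier_bits) @ copier_bits"
    by (simp flip: replicate_append_same)
  with Suc show ?case
    by (simp add: copiers_Suc assemble_append table_bits_append copier_bits_def)
qed

lemma sampler_add: "sampler c (M + N) = sampler c M @ copiers N"
  by (simp add: sampler_def copiers_add)

lemma table_sampler_code_mult:
  "table (sampler_code k c (length copier_bits * e)) = assemble (sampler c (k + e))"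
  unfolding sampler_code_def cycle_mult concat_copier_bits sampler_add assemble_append
  using table_nat_of_bits[of "assemble (sampler c k) @ assemble (copiers e)" "[]"]
  by (simp add: table_bits_append)

text \<open>The cut falls behind the complete header and its first \<open>k\<close> copiers, so the
  states that serve input 0 are always intact.\<close>

lemma table_sampler_code:
  "\<exists>i\<ge>6 * (length (bits_of_nat c) + 2). table (sampler_code k c L) = take i (assemble (sampler c (k + L)))"
proof -
  obtain i where "blocks 0 (take L (table_bits (assemble (copiers L)))) =
      take i (blocks 0 (table_bits (assemble (copiers L))))"
    using blocks_take by blast
  also have "blocks 0 (table_bits (assemble (copiers L))) = assemble (copiers L)"
    using blocks_table_bits[of _ "[]"] by simp
  finally have "table (sampler_code k c L) = assemble (sampler c k) @ take i (assemble (copiers L))"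
    unfolding sampler_code_def cycle_take[OF copier_bits_nonempty] concat_copier_bits table_nat_of_bits
    by simp
  then have "table (sampler_code k c L) =
      take (6 * length (sampler c k) + i) (assemble (sampler c (k + L)))"
    by (simp add: sampler_add assemble_append)
  moreover have "6 * (length (bits_of_nat c) + 2) \<le> 6 * length (sampler c k) + i"
    by (simp add: sampler_def)
  ultimately show ?thesis by blast
qed

lemma computes_sampler_code_0:
  assumes "bits_of_nat c = True # bs"
  shows "computes u (sampler_code k c L) 0 c"
  unfolding computes_def using table_sampler_code[of c k L] sampler_0[OF _ assms] by force

lemma computes_sampler_code_1:
  "\<exists>x. computes u (sampler_code k c L) 1 x"
  unfolding computes_def using table_sampler_code[of c k L] sampler_1_halts by fastforce

lemma computes_sampler_code_mult:
  "computes u (sampler_code k c (length copier_bits * e)) 1 (nat_of_bits (False # rev (map u [0..<k + e])))"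
  unfolding computes_def table_sampler_code_mult by (rule sampler_1)

section \<open>Realisability of negative sentences\<close>

lemma prob_space_coin: "prob_space coin"
  unfolding coin_def by (intro prob_space_PiM prob_space_measure_pmf)

lemma emeasure_coin_UNIV: "emeasure coin UNIV = 1"
  using prob_space.emeasure_space_1[OF prob_space_coin] by simp

text \<open>A negative formula asks for no information, so a realiser only has to be unfolded as
  often as connectives are nested. Every input, be it an index, a numeral or a realiser of a
  premise, gets the same answer.\<close>

primrec canonical :: "nat \<Rightarrow> nat" where
  "canonical 0 = const_program 0"
| "canonical (Suc d) = const_program (canonical d)"

lemma ordinary_canonical: "ordinary (canonical d)"
  by (cases d) (simp_all add: ordinary_const_program)

lemma computes_canonical: "computes u (canonical (Suc d)) n (canonical d)"
  by (simp add: computes_const_program)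

lemma app_canonical: "app (canonical (Suc d)) n (canonical d)"
  by (simp add: app_const_program)

lemma hd_bits_canonical: "\<exists>bs. bits_of_nat (canonical d) = True # bs"
  by (cases d) (simp_all add: hd_bits_const_program)

lemma realises_negative:
  assumes "negative \<phi>" "closed_fm 0 \<phi>"
  shows "(sat \<rho> \<phi> \<longrightarrow> (\<forall>d\<ge>depth \<phi>. realises (canonical d) \<phi>)) \<and> ((\<exists>e. realises e \<phi>) \<longrightarrow> sat \<rho> \<phi>)"
  using assms
proof (induction "depth \<phi>" arbitrary: \<phi> rule: less_induct)
  case less
  show ?case
  proof (cases \<phi>)
    case (Eq t s)
    then show ?thesis
      using less.prems by (auto simp: val_closed_tm[of _ \<rho>] ordinary_canonical)
  next
    case (Conj \<alpha> \<beta>)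
    have hyps: "depth \<alpha> < depth \<phi>" "negative \<alpha>" "closed_fm 0 \<alpha>"
      "depth \<beta> < depth \<phi>" "negative \<beta>" "closed_fm 0 \<beta>"
      using less.prems Conj by auto
    note ih = less.hyps[OF hyps(1-3)] less.hyps[OF hyps(4-6)]
    have IH: "sat \<rho> \<alpha> \<Longrightarrow> depth \<alpha> \<le> d \<Longrightarrow> realises (canonical d) \<alpha>"
      "sat \<rho> \<beta> \<Longrightarrow> depth \<beta> \<le> d \<Longrightarrow> realises (canonical d) \<beta>"
      "realises e \<alpha> \<Longrightarrow> sat \<rho> \<alpha>" "realises e \<beta> \<Longrightarrow> sat \<rho> \<beta>" for d e
      using ih by blast+
    have "sat \<rho> \<phi>" if "realises e \<phi>" for e
      using that Conj IH(3,4) by auto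
    moreover have "realises (canonical d) \<phi>" if sat: "sat \<rho> \<phi>" and le: "depth \<phi> \<le> d" for d
    proof -
      obtain d' where d: "d = Suc d'" "depth \<alpha> \<le> d'" "depth \<beta> \<le> d'"
        using le Conj by (cases d) auto
      then show ?thesis
        using sat Conj IH(1,2)[of d'] ordinary_canonical[of "Suc d'"] app_canonical[of d']
        by (simp del: canonical.simps) blast
    qed
    ultimately show ?thesis by blast
  next
    case (Imp \<alpha> \<beta>)
    have hyps: "depth \<alpha> < depth \<phi>" "negative \<alpha>" "closed_fm 0 \<alpha>"
      "depth \<beta> < depth \<phi>" "negative \<beta>" "closed_fm 0 \<beta>"
      using less.prems Imp by auto
    note ih = less.hyps[OF hyps(1-3)] less.hyps[OF hyps(4-6)]
    have IH: "sat \<rho> \<alpha> \<Longrightarrow> depth \<alpha> \<le> d \<Longrightarrow> realises (canonical d) \<alpha>"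
      "sat \<rho> \<beta> \<Longrightarrow> depth \<beta> \<le> d \<Longrightarrow> realises (canonical d) \<beta>"
      "realises e \<alpha> \<Longrightarrow> sat \<rho> \<alpha>" "realises e \<beta> \<Longrightarrow> sat \<rho> \<beta>" for d e
      using ih by blast+
    have "sat \<rho> \<phi>" if "realises e \<phi>" for e
      using that Imp IH(1)[OF _ order_refl] IH(4) by auto
    moreover have "realises (canonical d) \<phi>" if sat: "sat \<rho> \<phi>" and le: "depth \<phi> \<le> d" for d
    proof -
      obtain d' where d: "d = Suc d'" "depth \<beta> \<le> d'"
        using le Imp by (cases d) auto
      then show ?thesis
        using sat Imp IH(2)[of d'] IH(3) ordinary_canonical[of "Suc d'"] app_canonical[of d']
        by (simp del: canonical.simps) blast
    qed
    ultimately show ?thesis by blast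
  next
    case (Forall \<alpha>)
    have "depth (inst_fm 0 n \<alpha>) < depth \<phi>" "negative (inst_fm 0 n \<alpha>)" "closed_fm 0 (inst_fm 0 n \<alpha>)" for n
      using less.prems Forall by (auto simp: closed_inst_fm)
    note ih = less.hyps[OF this, unfolded sat_inst_fm_0 depth_inst_fm]
    have IH: "sat (case_nat n \<rho>) \<alpha> \<Longrightarrow> depth \<alpha> \<le> d \<Longrightarrow> realises (canonical d) (inst_fm 0 n \<alpha>)"
      "realises e (inst_fm 0 n \<alpha>) \<Longrightarrow> sat (case_nat n \<rho>) \<alpha>" for d e n
      using ih by blast+
    have "sat \<rho> \<phi>" if "realises e \<phi>" for e
      using that IH(2) unfolding Forall by simp blast
    moreover have "realises (canonical d) \<phi>" if sat: "sat \<rho> \<phi>" and le: "depth \<phi> \<le> d" for d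
    proof -
      obtain d' where d: "d = Suc d'" "depth \<alpha> \<le> d'"
        using le Forall by (cases d) auto
      then show ?thesis
        using sat Forall IH(1)[of _ d'] ordinary_canonical[of "Suc d'"] app_canonical[of d']
        by (simp del: canonical.simps) blast
    qed
    ultimately show ?thesis by blast
  qed (use less.prems in auto)
qed

lemma mu_realises_nonempty: "mu_realises p \<phi> \<Longrightarrow> \<exists>u. orealises p u \<phi>"
  unfolding mu_realises.simps
proof (rule ccontr, elim exE conjE)
  fix r :: real
  assume "\<nexists>u. orealises p u \<phi>"
  then have "{u. orealises p u \<phi>} = {}" by blast
  moreover assume "0 < r" "ennreal r \<le> emeasure coin {u. orealises p u \<phi>}"
  ultimately show False by (simp add: ennreal_eq_0_iff)
qed

lemma mu_realises_UNIV: "(\<And>u. orealises p u \<phi>) \<Longrightarrow> mu_realises p \<phi>"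
  unfolding mu_realises.simps by (intro exI[of _ 1]) (simp add: emeasure_coin_UNIV)

text \<open>The canonical realisers work for every oracle, whereas a single oracle suffices to infer
  truth. These extremes bridge the passage to \<open>mu_realises\<close> in implications, as
  positive measure lies between them.\<close>

lemma orealises_negative:
  assumes "negative \<phi>" "closed_fm 0 \<phi>"
  shows "(sat \<rho> \<phi> \<longrightarrow> (\<forall>d\<ge>depth \<phi>. \<forall>u. orealises (canonical d) u \<phi>)) \<and>
    ((\<exists>p u. orealises p u \<phi>) \<longrightarrow> sat \<rho> \<phi>)"
  using assms
proof (induction "depth \<phi>" arbitrary: \<phi> rule: less_induct)
  case less
  show ?case
  proof (cases \<phi>)
    case (Eq t s)
    then show ?thesis
      using less.prems by (auto simp: val_closed_tm[of _ \<rho>])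
  next
    case (Conj \<alpha> \<beta>)
    have hyps: "depth \<alpha> < depth \<phi>" "negative \<alpha>" "closed_fm 0 \<alpha>"
      "depth \<beta> < depth \<phi>" "negative \<beta>" "closed_fm 0 \<beta>"
      using less.prems Conj by auto
    note ih = less.hyps[OF hyps(1-3)] less.hyps[OF hyps(4-6)]
    have IH: "sat \<rho> \<alpha> \<Longrightarrow> depth \<alpha> \<le> d \<Longrightarrow> orealises (canonical d) u \<alpha>"
      "sat \<rho> \<beta> \<Longrightarrow> depth \<beta> \<le> d \<Longrightarrow> orealises (canonical d) u \<beta>"
      "orealises p u \<alpha> \<Longrightarrow> sat \<rho> \<alpha>" "orealises p u \<beta> \<Longrightarrow> sat \<rho> \<beta>" for d p u
      using ih by blast+
    have "sat \<rho> \<phi>" if "orealises p u \<phi>" for p u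
      using that Conj IH(3,4) by auto
    moreover have "orealises (canonical d) u \<phi>" if sat: "sat \<rho> \<phi>" and le: "depth \<phi> \<le> d" for d u
    proof -
      obtain d' where d: "d = Suc d'" "depth \<alpha> \<le> d'" "depth \<beta> \<le> d'"
        using le Conj by (cases d) auto
      then show ?thesis
        using sat Conj IH(1,2)[of d'] computes_canonical[of _ d']
        by (simp del: canonical.simps) blast
    qed
    ultimately show ?thesis by blast
  next
    case (Imp \<alpha> \<beta>)
    have hyps: "depth \<alpha> < depth \<phi>" "negative \<alpha>" "closed_fm 0 \<alpha>"
      "depth \<beta> < depth \<phi>" "negative \<beta>" "closed_fm 0 \<beta>"
      using less.prems Imp by auto
    note ih = less.hyps[OF hyps(1-3)] less.hyps[OF hyps(4-6)]
    have IH: "sat \<rho> \<alpha> \<Longrightarrow> depth \<alpha> \<le> d \<Longrightarrow> mu_realises (canonical d) \<alpha>"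
      "sat \<rho> \<beta> \<Longrightarrow> depth \<beta> \<le> d \<Longrightarrow> mu_realises (canonical d) \<beta>"
      "mu_realises p \<alpha> \<Longrightarrow> sat \<rho> \<alpha>" "mu_realises p \<beta> \<Longrightarrow> sat \<rho> \<beta>" for d p
      using ih mu_realises_UNIV mu_realises_nonempty by blast+
    have "sat \<rho> \<phi>" if "orealises p u \<phi>" for p u
      using that Imp IH(1)[OF _ order_refl] IH(4) by auto
    moreover have "orealises (canonical d) u \<phi>" if sat: "sat \<rho> \<phi>" and le: "depth \<phi> \<le> d" for d u
    proof -
      obtain d' where d: "d = Suc d'" "depth \<beta> \<le> d'"
        using le Imp by (cases d) auto
      then show ?thesis
        using sat Imp IH(2)[of d'] IH(3) computes_canonical[of _ d']
        by (simp del: canonical.simps) blast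
    qed
    ultimately show ?thesis by blast
  next
    case (Forall \<alpha>)
    have "depth (inst_fm 0 n \<alpha>) < depth \<phi>" "negative (inst_fm 0 n \<alpha>)" "closed_fm 0 (inst_fm 0 n \<alpha>)" for n
      using less.prems Forall by (auto simp: closed_inst_fm)
    note ih = less.hyps[OF this, unfolded sat_inst_fm_0 depth_inst_fm]
    have IH: "sat (case_nat n \<rho>) \<alpha> \<Longrightarrow> depth \<alpha> \<le> d \<Longrightarrow> orealises (canonical d) u (inst_fm 0 n \<alpha>)"
      "orealises p u (inst_fm 0 n \<alpha>) \<Longrightarrow> sat (case_nat n \<rho>) \<alpha>" for d p u n
      using ih by blast+
    have "sat \<rho> \<phi>" if "orealises p u \<phi>" for p u
      using that IH(2) unfolding Forall by simp blast
    moreover have "orealises (canonical d) u \<phi>" if sat: "sat \<rho> \<phi>" and le: "depth \<phi> \<le> d" for d u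
    proof -
      obtain d' where d: "d = Suc d'" "depth \<alpha> \<le> d'"
        using le Forall by (cases d) auto
      then show ?thesis
        using sat Forall IH(1)[of _ d'] computes_canonical[of _ d']
        by (simp del: canonical.simps) blast
    qed
    ultimately show ?thesis by blast
  qed (use less.prems in auto)
qed

section \<open>Bounding the free variables\<close>

lemma closed_tm_mono: "closed_tm k t \<Longrightarrow> k \<le> k' \<Longrightarrow> closed_tm k' t"
  by (induction t) auto

lemma closed_fm_mono: "closed_fm k \<phi> \<Longrightarrow> k \<le> k' \<Longrightarrow> closed_fm k' \<phi>"
  by (induction \<phi> arbitrary: k k') (auto simp: closed_tm_mono)

lemma ex_closed_tm: "\<exists>k. closed_tm k t"
proof (induction t)
  case (Plus t s)
  then obtain k k' where "closed_tm k t" "closed_tm k' s" by blast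
  then show ?case by (auto intro!: exI[of _ "max k k'"] elim: closed_tm_mono)
next
  case (Times t s)
  then obtain k k' where "closed_tm k t" "closed_tm k' s" by blast
  then show ?case by (auto intro!: exI[of _ "max k k'"] elim: closed_tm_mono)
qed auto

lemma ex_closed_fm: "\<exists>k. closed_fm k \<phi>"
proof (induction \<phi>)
  case (Eq t s)
  obtain k k' where "closed_tm k t" "closed_tm k' s" using ex_closed_tm by blast
  then show ?case by (auto intro!: exI[of _ "max k k'"] elim: closed_tm_mono)
next
  case (Conj \<phi> \<psi>)
  then obtain k k' where "closed_fm k \<phi>" "closed_fm k' \<psi>" by blast
  then show ?case by (auto intro!: exI[of _ "max k k'"] elim: closed_fm_mono)
next
  case (Disj \<phi> \<psi>)
  then obtain k k' where "closed_fm k \<phi>" "closed_fm k' \<psi>" by blast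
  then show ?case by (auto intro!: exI[of _ "max k k'"] elim: closed_fm_mono)
next
  case (Imp \<phi> \<psi>)
  then obtain k k' where "closed_fm k \<phi>" "closed_fm k' \<psi>" by blast
  then show ?case by (auto intro!: exI[of _ "max k k'"] elim: closed_fm_mono)
next
  case (Exists \<phi>)
  then obtain k where "closed_fm k \<phi>" by blast
  then show ?case by (auto intro!: exI[of _ k] elim: closed_fm_mono)
next
  case (Forall \<phi>)
  then obtain k where "closed_fm k \<phi>" by blast
  then show ?case by (auto intro!: exI[of _ k] elim: closed_fm_mono)
qed auto

text \<open>\<open>arithmetical\<close> does not control free variables. As \<open>P\<close> depends
  only on those below \<open>k\<close>, the surplus ones can be set to 0, the highest first, so that
  no other variable is renumbered.\<close>

lemma arithmetical_closed_fm:
  assumes "arithmetical P" and P: "\<And>\<rho> \<rho>'. (\<And>i. i < k \<Longrightarrow> \<rho> i = \<rho>' i) \<Longrightarrow> P \<rho> \<longleftrightarrow> P \<rho>'"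
  shows "\<exists>\<phi>. negative \<phi> \<and> closed_fm k \<phi> \<and> (\<forall>\<rho>. sat \<rho> \<phi> \<longleftrightarrow> P \<rho>)"
proof -
  have *: "\<exists>\<psi>. negative \<psi> \<and> closed_fm k \<psi> \<and> (\<forall>\<rho>. sat \<rho> \<psi> \<longleftrightarrow> P \<rho>)"
    if "negative \<phi>" "closed_fm (k + j) \<phi>" "\<forall>\<rho>. sat \<rho> \<phi> \<longleftrightarrow> P \<rho>" for \<phi> j
    using that
  proof (induction j arbitrary: \<phi>)
    case (Suc j)
    let ?\<psi> = "inst_fm (k + j) 0 \<phi>"
    have "sat \<rho> ?\<psi> \<longleftrightarrow> P \<rho>" for \<rho>
      unfolding sat_inst_fm Suc.prems(3)[rule_format] by (rule P) simp
    moreover have "closed_fm (k + j) ?\<psi>"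
      using Suc.prems(2) by (intro closed_inst_fm) simp_all
    ultimately show ?case using Suc.IH[of ?\<psi>] Suc.prems(1) by simp
  qed auto
  obtain \<phi> where \<phi>: "negative \<phi>" "\<forall>\<rho>. sat \<rho> \<phi> \<longleftrightarrow> P \<rho>"
    using assms(1) unfolding arithmetical_def by blast
  moreover obtain k' where "closed_fm k' \<phi>" using ex_closed_fm by blast
  then have "closed_fm (k + k') \<phi>" by (rule closed_fm_mono) simp
  ultimately show ?thesis using * by blast
qed

section \<open>The separating sentence\<close>

text \<open>
  A value that the program \<open>e\<close> would commit itself to on the input \<open>n\<close>, where only one input \<open>n\<close>
  is used against \<open>e\<close>. The string of that input consists of \<open>e\<close> times the length of
  \<open>copier_bits\<close> digits \<open>1\<close>, so the sampling program maps it to a machine with \<open>e\<close> further copiers.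
\<close>

definition diagonal :: "nat \<Rightarrow> nat \<Rightarrow> nat \<Rightarrow> bool" where
  "diagonal e n x \<longleftrightarrow> Suc n = (2 ^ length copier_bits) ^ e \<and> (\<exists>a. app e n a \<and> app a 1 x)"

text \<open>Each program excludes at most one value altogether: its code determines the input, and
  computations are deterministic. The measure estimate rests on this.\<close>

lemma diagonal_unique:
  assumes "diagonal e n x" "diagonal e n' x'"
  shows "x = x'"
proof -
  obtain a a' where a: "app e n a" "app a 1 x" "app e n' a'" "app a' 1 x'"
    using assms by (auto simp: diagonal_def)
  have "n = n'" using assms by (simp add: diagonal_def)
  then have "a = a'" using a computes_unique unfolding app_def by blast
  then show ?thesis using a computes_unique unfolding app_def by blast
qed

lemma arithmetical_diagonal: "arithmetical (\<lambda>\<rho>. \<not> (\<exists>e. diagonal e (\<rho> 1) (\<rho> 0)))"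
proof -
  \<comment> \<open>\<open>arithmetical_app\<close> is stated for variables, so the constant input 1
    enters through the bound variable \<open>o1\<close>.\<close>
  have "arithmetical (\<lambda>\<rho>. \<not> (\<exists>e. Suc (\<rho> 1) = (2 ^ length copier_bits) ^ e \<and>
      (\<exists>a o1. o1 = 1 \<and> app e (\<rho> 1) a \<and> app a o1 (\<rho> 0))))"
    by (intro arith_fun_intros arithmetical_app)
  then show ?thesis by (simp add: diagonal_def)
qed

lemma ex_diagonal_fm:
  "\<exists>\<phi>. negative \<phi> \<and> closed_fm 2 \<phi> \<and> (\<forall>\<rho>. sat \<rho> \<phi> \<longleftrightarrow> \<not> (\<exists>e. diagonal e (\<rho> 1) (\<rho> 0)))"
  by (rule arithmetical_closed_fm[OF arithmetical_diagonal]) simp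

lemma sat_inst_inst_fm:
  assumes "\<forall>\<rho>. sat \<rho> \<phi> \<longleftrightarrow> P (\<rho> 1) (\<rho> 0)"
  shows "sat \<rho> (inst_fm 0 x (inst_fm (Suc 0) n \<phi>)) \<longleftrightarrow> P n x"
  unfolding sat_inst_fm assms[rule_format] by simp

lemma not_realisable_diagonal:
  assumes \<phi>: "negative \<phi>" "closed_fm 2 \<phi>" "\<forall>\<rho>. sat \<rho> \<phi> \<longleftrightarrow> \<not> (\<exists>e. diagonal e (\<rho> 1) (\<rho> 0))"
  shows "\<not> realisable (Forall (Exists \<phi>))"
proof
  assume "realisable (Forall (Exists \<phi>))"
  then obtain e where e: "realises e (Forall (Exists \<phi>))"
    unfolding realisable_def by blast
  \<comment> \<open>The input reserved for \<open>e\<close> itself: the answer of \<open>e\<close>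
    at this place is excluded by the very sentence that it is supposed to realise.\<close>
  define n where "n = ((2::nat) ^ length copier_bits) ^ e - 1"
  have n: "Suc n = (2 ^ length copier_bits) ^ e"
    by (simp add: n_def)
  from e obtain a where a: "app e n a" "realises a (inst_fm 0 n (Exists \<phi>))"
    by (auto simp del: inst_fm.simps)
  then obtain b x where x: "app a 1 x" "realises b (inst_fm 0 x (inst_fm (Suc 0) n \<phi>))"
    by auto
  let ?\<psi> = "inst_fm 0 x (inst_fm (Suc 0) n \<phi>)"
  have "negative ?\<psi>" "closed_fm 0 ?\<psi>"
    using \<phi>(1,2) by (simp_all add: closed_inst_fm numeral_2_eq_2)
  from realises_negative[OF this, of "\<lambda>_. 0"] x(2) have "sat (\<lambda>_. 0) ?\<psi>" by blast
  then have "\<not> (\<exists>e. diagonal e n x)"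
    using sat_inst_inst_fm[OF \<phi>(3)] by blast
  moreover have "diagonal e n x"
    using n a(1) x(1) by (auto simp: diagonal_def)
  ultimately show False by blast
qed

section \<open>Measure of the successful oracles\<close>

lemma measure_coin_cylinder: "measure coin {u. \<forall>i<N. u i = v i} = (1/2) ^ N"
proof -
  let ?M = "\<lambda>_ :: nat. measure_pmf (bernoulli_pmf (1/2))"
  interpret product_prob_space ?M UNIV
    by unfold_locales
  have "emeasure coin {u \<in> space coin. \<forall>i\<in>{..<N}. u i \<in> {v i}} = (\<Prod>i\<in>{..<N}. emeasure (?M i) {v i})"
    unfolding coin_def by (rule emeasure_PiM_Collect) auto
  also have "emeasure (?M i) {v i} = ennreal (1/2)" for i
    by (cases "v i") (simp_all add: emeasure_pmf_single)
  then have "(\<Prod>i\<in>{..<N}. emeasure (?M i) {v i}) = ennreal ((1/2) ^ N)"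
    by (simp only: prod_constant card_lessThan ennreal_power)
  finally have "emeasure coin {u. \<forall>i<N. u i = v i} = ennreal ((1/2) ^ N)"
    by (simp add: Ball_def lessThan_def)
  then show ?thesis by (simp add: measure_def)
qed

lemma sets_coin_cylinder: "{u. \<forall>i<N. u i = v i} \<in> sets coin"
proof -
  note measurable_coin_component [measurable]
  have "{u \<in> space coin. \<forall>i<N. u i = v i} \<in> sets coin" by measurable
  then show ?thesis by simp
qed

text \<open>The reason for reserving powers of 2 minus 1: their length in bijective base 2 is the
  exponent.\<close>

lemma nat_of_bits_replicate_False: "Suc (nat_of_bits (replicate j False)) = 2 ^ j"
  by (induction j) simp_all

text \<open>A witness can fail only at an input reserved for some \<open>e\<close>. There the length
  of the input makes the witness the sample of exactly \<open>k + e\<close> bits, which the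
  hypothesis on \<open>u\<close> protects.\<close>

lemma orealises_sampling_program:
  assumes \<phi>: "negative \<phi>" "closed_fm 2 \<phi>" "\<forall>\<rho>. sat \<rho> \<phi> \<longleftrightarrow> \<not> (\<exists>e. diagonal e (\<rho> 1) (\<rho> 0))"
    and u: "\<And>e n. \<not> diagonal e n (nat_of_bits (False # rev (map u [0..<k + e])))"
  shows "orealises (sampling_program k (canonical (depth \<phi>))) u (Forall (Exists \<phi>))"
proof -
  let ?c = "canonical (depth \<phi>)"
  obtain bs where c: "bits_of_nat ?c = True # bs" using hd_bits_canonical by blast
  have "orealises (sampler_code k ?c (length (bits_of_nat n))) u (inst_fm 0 n (Exists \<phi>))" for n
  proof -
    let ?a = "sampler_code k ?c (length (bits_of_nat n))"
    obtain x where x: "computes u ?a 1 x" using computes_sampler_code_1 by blast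
    let ?\<psi> = "inst_fm 0 x (inst_fm (Suc 0) n \<phi>)"
    have "\<not> diagonal e n x" for e
    proof
      assume diag: "diagonal e n x"
      then have "Suc n = 2 ^ (length copier_bits * e)"
        by (simp add: diagonal_def power_mult)
      then have "n = nat_of_bits (replicate (length copier_bits * e) False)"
        using nat_of_bits_replicate_False by (metis nat.inject)
      then have "length (bits_of_nat n) = length copier_bits * e"
        by simp
      then have "x = nat_of_bits (False # rev (map u [0..<k + e]))"
        using x computes_sampler_code_mult computes_unique by metis
      with u diag show False by blast
    qed
    then have "sat (\<lambda>_. 0) ?\<psi>"
      using sat_inst_inst_fm[OF \<phi>(3)] by blast
    moreover have "negative ?\<psi>" "closed_fm 0 ?\<psi>"
      using \<phi>(1,2) by (simp_all add: closed_inst_fm numeral_2_eq_2)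
    \<comment> \<open>Instantiation preserves depth, so the one constant \<open>?c\<close> serves
      for all \<open>n\<close> and \<open>x\<close>.\<close>
    ultimately have "orealises ?c u ?\<psi>"
      using orealises_negative[of ?\<psi> "\<lambda>_. 0"] by simp
    with computes_sampler_code_0[OF c] x show ?thesis by auto
  qed
  with computes_sampling_program show ?thesis
    unfolding orealises.simps by blast
qed

text \<open>By \<open>diagonal_unique\<close>, two oracles that are bad for the same
  \<open>e\<close> agree on their first \<open>k + e\<close> bits, so they lie in one cylinder of
  measure \<open>(1/2) ^ (k + e)\<close>. The geometric series over \<open>e\<close> gives the
  bound. Covering by cylinders takes the place of a proof that the bad sets are measurable.\<close>

lemma measure_realiser_set_sampling_program:
  assumes \<phi>: "negative \<phi>" "closed_fm 2 \<phi>" "\<forall>\<rho>. sat \<rho> \<phi> \<longleftrightarrow> \<not> (\<exists>e. diagonal e (\<rho> 1) (\<rho> 0))"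
  shows "measure coin (realiser_set (sampling_program k (canonical (depth \<phi>))) (Forall (Exists \<phi>)))
    \<ge> 1 - 2 * (1/2) ^ k" (is "measure coin ?R \<ge> _")
proof -
  interpret prob_space coin by (rule prob_space_coin)
  define bad where "bad e = {u. \<exists>n. diagonal e n (nat_of_bits (False # rev (map u [0..<k + e])))}" for e
  have "\<exists>A. A \<in> sets coin \<and> bad e \<subseteq> A \<and> measure coin A \<le> (1/2) ^ (k + e)" for e
  proof (cases "bad e = {}")
    case True
    then show ?thesis by (intro exI[of _ "{}"]) simp
  next
    case False
    then obtain v where v: "v \<in> bad e" by blast
    have "bad e \<subseteq> {u. \<forall>i<k + e. u i = v i}"
    proof (intro subsetI CollectI allI impI)
      fix u i assume u: "u \<in> bad e" and i: "i < k + e"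
      from u v have "nat_of_bits (False # rev (map u [0..<k + e])) = nat_of_bits (False # rev (map v [0..<k + e]))"
        unfolding bad_def by (blast dest: diagonal_unique)
      then have "map u [0..<k + e] = map v [0..<k + e]"
        by (metis bits_of_nat_of_bits list.inject rev_is_rev_conv)
      then show "u i = v i" using i by (simp add: map_eq_conv)
    qed
    then show ?thesis
      using sets_coin_cylinder[of "k + e" v] measure_coin_cylinder[of "k + e" v] by auto
  qed
  then obtain A where A: "\<And>e. A e \<in> sets coin" "\<And>e. bad e \<subseteq> A e" "\<And>e. measure coin (A e) \<le> (1/2) ^ (k + e)"
    by metis
  have sums: "(\<lambda>e. (1/2::real) ^ (k + e)) sums (2 * (1/2) ^ k)"
    using sums_mult[OF geometric_sums[of "1/2::real"], of "(1/2) ^ k"] by (simp add: power_add mult.commute)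
  have summable: "summable (\<lambda>e. measure coin (A e))"
    by (rule summable_comparison_test'[OF sums_summable[OF sums]]) (use A(3) in simp)
  have "measure coin (\<Union>e. A e) \<le> (\<Sum>e. measure coin (A e))"
    using A(1) summable by (intro finite_measure_subadditive_countably) auto
  also have "\<dots> \<le> 2 * (1/2) ^ k"
    using suminf_le[OF A(3) summable sums_summable[OF sums]] sums_unique[OF sums] by simp
  finally have "measure coin (\<Union>e. A e) \<le> 2 * (1/2) ^ k" .
  moreover have "- (\<Union>e. A e) \<subseteq> ?R"
  proof
    fix u assume "u \<in> - (\<Union>e. A e)"
    then have "u \<notin> bad e" for e using A(2) by blast
    then show "u \<in> ?R"
      unfolding realiser_set_def mem_Collect_eq
      by (intro orealises_sampling_program[OF \<phi>]) (auto simp: bad_def)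
  qed
  then have "measure coin (- (\<Union>e. A e)) \<le> measure coin ?R"
    by (rule finite_measure_mono) (rule realiser_set_measurable)
  moreover have "measure coin (- (\<Union>e. A e)) = 1 - measure coin (\<Union>e. A e)"
    using prob_compl[of "\<Union>e. A e"] A(1) by (simp add: Compl_eq_Diff_UNIV sets.countable_UN)
  ultimately show ?thesis by linarith
qed

lemma mu_realisableI:
  assumes "\<And>k. measure coin (realiser_set (p k) \<phi>) \<ge> r k" and r: "r \<longlonglongrightarrow> 1"
  shows "mu_realisable \<phi>"
proof -
  interpret prob_space coin by (rule prob_space_coin)
  let ?S = "Sup {emeasure coin (realiser_set p \<phi>) | p. mu_realises p \<phi>}"
  have "?S \<le> 1"
    by (intro Sup_least) (auto intro: emeasure_le_1)
  moreover have "1 \<le> ?S"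
  proof (rule LIMSEQ_le_const2)
    show "(\<lambda>k. ennreal (r k)) \<longlonglongrightarrow> 1"
      using tendsto_ennrealI[OF r] by simp
    \<comment> \<open>The supremum ranges only over programs whose set of oracles has positive
      measure, and \<open>r k\<close> guarantees this only where it is positive;
      \<open>1 - 2 * (1/2) ^ k\<close>, for example, is not for \<open>k\<close> at most 1.\<close>
    have "\<forall>\<^sub>F k in sequentially. r k > 0"
      using order_tendstoD(1)[OF r, of 0] by simp
    then obtain K where K: "\<And>k. k \<ge> K \<Longrightarrow> r k > 0"
      by (auto simp: eventually_sequentially)
    have "ennreal (r k) \<le> ?S" if "k \<ge> K" for k
    proof -
      have le: "ennreal (r k) \<le> emeasure coin (realiser_set (p k) \<phi>)"
        using assms(1)[of k] by (simp add: emeasure_eq_measure ennreal_leI)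
      then have "mu_realises (p k) \<phi>"
        using K[OF that] by (auto simp: mu_realises_iff mu_realises_ge_def)
      with le show ?thesis by (intro order_trans[OF le] Sup_upper) blast
    qed
    then show "\<exists>K. \<forall>k\<ge>K. ennreal (r k) \<le> ?S" by blast
  qed
  ultimately show ?thesis by (simp add: mu_realisable_def)
qed

theorem theorem2:
  shows "\<exists>\<phi>. sentence \<phi> \<and> mu_realisable \<phi> \<and> \<not> realisable \<phi>"
proof -
  obtain \<phi> where \<phi>: "negative \<phi>" "closed_fm 2 \<phi>"
    "\<forall>\<rho>. sat \<rho> \<phi> \<longleftrightarrow> \<not> (\<exists>e. diagonal e (\<rho> 1) (\<rho> 0))"
    using ex_diagonal_fm by blast
  have "sentence (Forall (Exists \<phi>))"
    using \<phi>(2) by (simp add: sentence_def numeral_2_eq_2)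
  moreover have "(\<lambda>k. 1 - 2 * (1/2::real) ^ k) \<longlonglongrightarrow> 1"
    by (rule tendsto_eq_intros | simp add: LIMSEQ_realpow_zero)+
  with measure_realiser_set_sampling_program[OF \<phi>] have "mu_realisable (Forall (Exists \<phi>))"
    by (rule mu_realisableI)
  ultimately show ?thesis
    using not_realisable_diagonal[OF \<phi>] by blast
qed

end
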